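(* Let $p\in[0,1]$ and consider the percolation Markov decision process (PMDP) on $\mathbb{Z}$ with action set $I=\{+1,+2\}$ and i.i.d. $\mathrm{Bernoulli}(p)$ payoffs on the edges. For a finite horizon $n$ (number of remaining stages), an integer $k\ge0$, $a,c,d\in\{0,1\}$ and $(c,d)\ne(1,0)$, the strategy $$\begin{aligned}\sigma^*(\underline{0}\overline{1})&=+2,\\ \sigma^*(\underline{1}\overline{0})&=+1,\\ \sigma^*(\underline{a}\overline{a}\underline{1})&=+1,\\ \sigma^*(\underline{a}\overline{a}\underline{0}(\overline{1}\underline{0})^k\overline{c}\underline{d})&=\begin{cases}\text{indifferent (either action)} & \text{if } n<k,\\ +2 & \text{if } n\ge k \text{ and } k \text{ is even},\\ +1 & \text{if } n\ge k\text{ and } k\text{ is odd},\end{cases}\end{aligned}$$ is optimal in any finitely repeated decision process with $n$ stages. Moreover, letting $n$ go to $+\infty$ in this rule (i.e. always applying the parity rule in the last case), the resulting strategy is optimal for the $\lambda$-discounted decision process for every $\lambda\in(0,1]$, and the uniform value is $$v_\infty(p)=\frac{p^6-2p^5-2p^4+6p^3-4p^2}{2p^5-7p^4+7p^3-2p^2-p}$$ (for $p=0$ the right-hand side is read as its limit $0$).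
   Context: The PMDP: $\{g_\omega(z,i)\}_{z\in\mathbb{Z},\,i\in\{1,2\}}$ are i.i.d. $\mathrm{Bernoulli}(p)$ random variables on a probability space $(\Omega,\mathscr{F},\mathbb{P})$, whose realization is known in advance to the decision maker. A strategy is a sequence $\sigma=(\sigma_m)_{m\ge1}$ of maps $\sigma_m:\Omega\times\mathbb{Z}\to I$, measurable with respect to the product of the $\sigma$-algebra generated by the payoffs and $\mathcal{P}(\mathbb{Z})$; from initial state $z$ it induces $z_1=z$, $i_m=\sigma_m(\omega,z)$, $z_{m+1}=z_m+i_m$. The $N$-stage payoff is $\gamma_N^\omega(z,\sigma)=\frac1N\sum_{m=1}^N g_\omega(z_m,i_m)$, with value $v_N^\omega(z)=\max_\sigma\gamma_N^\omega(z,\sigma)$. For $\lambda\in(0,1]$ the $\lambda$-discounted payoff is $\lambda\sum_{m\ge1}(1-\lambda)^{m-1}g_\omega(z_m,i_m)$, with value its supremum over strategies. A strategy is optimal in the $N$-stage (resp. $\lambda$-discounted) process if it attains the corresponding value from every initial state (in the discounted case, almost surely). The limit value $v_\infty(p)$ is the $\mathbb{P}$-a.s. limit of $v_N(z)$ as $N\to\infty$ (a constant independent of $z$); it is the uniform value if for every $\varepsilon>0$ there is a strategy $\sigma$ such that, $\mathbb{P}$-a.s., $\gamma_N(z,\sigma)\ge v_\infty(p)-\varepsilon$ for all sufficiently large $N$. Pattern notation: underlined digits are payoffs of $+1$ edges and overlined digits payoffs of $+2$ edges, read from the current state $z$. Thus $\underline{a_0}\overline{b_0}\underline{a_1}\overline{b_1}\cdots$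 means $g_\omega(z,+1)=a_0$, $g_\omega(z,+2)=b_0$, $g_\omega(z+1,+1)=a_1$, $g_\omega(z+1,+2)=b_1$, etc. In particular, $\underline{a}\overline{a}\underline{0}(\overline{1}\underline{0})^k\overline{c}\underline{d}$ means $g_\omega(z,+1)=g_\omega(z,+2)=a$, $g_\omega(z+1,+1)=0$, $g_\omega(z+j,+2)=1$ and $g_\omega(z+j+1,+1)=0$ for $1\le j\le k$, $g_\omega(z+k+1,+2)=c$, $g_\omega(z+k+2,+1)=d$. The condition $(c,d)\neq(1,0)$ determines $k$ uniquely; if the block $\overline{1}\underline{0}$ repeats forever (a null event), either action may be played ($k=\infty$).
   Formalization: As printed, indifference for all n<k is false (n=4, k=5, c=d=0: +1 yields a+3, +2 at most a+2); in the finite-horizon claim either action is allowed only when n<k and n≤k/2+1, and for k/2+1<n<k the parity rule is applied. *)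

theory Defs
  imports "HOL-Probability.Probability"
begin

datatype act = Plus1 | Plus2

fun jump :: "act \<Rightarrow> int" where
  "jump Plus1 = 1"
| "jump Plus2 = 2"

locale pmdp = prob_space M
  for M :: "'w measure" +
  fixes g :: "'w \<Rightarrow> int \<Rightarrow> act \<Rightarrow> real" and p :: real
  assumes p_range: "0 \<le> p" "p \<le> 1"
    and payoff_01: "\<And>\<omega> z i. \<omega> \<in> space M \<Longrightarrow> g \<omega> z i \<in> {0, 1}"
    and payoff_bernoulli:
      "\<And>z i. distr M borel (\<lambda>\<omega>. g \<omega> z i) = distr (measure_pmf (bernoulli_pmf p)) borel of_bool"
    and payoff_indep: "indep_vars (\<lambda>_. borel) (\<lambda>(z, i) \<omega>. g \<omega> z i) UNIV"

definition payoff_algebra :: "'w measure \<Rightarrow> ('w \<Rightarrow> int \<Rightarrow> act \<Rightarrow> real) \<Rightarrow> 'w measure" where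
  "payoff_algebra M g =
     sigma (space M) {(\<lambda>\<omega>. g \<omega> z i) -` B \<inter> space M | z i B. B \<in> sets borel}"

(* Stages are counted from 0: sigma 0 is the action at the first stage, and state sigma w z m
   is the state after m moves.  The third argument of a strategy is the initial state. *)

type_synonym 'w strat = "nat \<Rightarrow> 'w \<Rightarrow> int \<Rightarrow> act"

definition strategy :: "'w measure \<Rightarrow> ('w \<Rightarrow> int \<Rightarrow> act \<Rightarrow> real) \<Rightarrow> 'w strat \<Rightarrow> bool" where
  "strategy M g \<sigma> \<longleftrightarrow>
     (\<forall>m. (\<lambda>(\<omega>, z). \<sigma> m \<omega> z)
        \<in> (payoff_algebra M g \<Otimes>\<^sub>M count_space (UNIV :: int set)) \<rightarrow>\<^sub>M count_space UNIV)"

primrec state :: "'w strat \<Rightarrow> 'w \<Rightarrow> int \<Rightarrow> nat \<Rightarrow> int" where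
  "state \<sigma> \<omega> z 0 = z"
| "state \<sigma> \<omega> z (Suc m) = state \<sigma> \<omega> z m + jump (\<sigma> m \<omega> z)"

definition stage_payoff ::
  "('w \<Rightarrow> int \<Rightarrow> act \<Rightarrow> real) \<Rightarrow> 'w strat \<Rightarrow> 'w \<Rightarrow> int \<Rightarrow> nat \<Rightarrow> real" where
  "stage_payoff g \<sigma> \<omega> z m = g \<omega> (state \<sigma> \<omega> z m) (\<sigma> m \<omega> z)"

definition payoff_N ::
  "('w \<Rightarrow> int \<Rightarrow> act \<Rightarrow> real) \<Rightarrow> nat \<Rightarrow> 'w \<Rightarrow> int \<Rightarrow> 'w strat \<Rightarrow> real" where
  "payoff_N g N \<omega> z \<sigma> = (\<Sum>m<N. stage_payoff g \<sigma> \<omega> z m) / real N"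

definition payoff_disc ::
  "('w \<Rightarrow> int \<Rightarrow> act \<Rightarrow> real) \<Rightarrow> real \<Rightarrow> 'w \<Rightarrow> int \<Rightarrow> 'w strat \<Rightarrow> real" where
  "payoff_disc g lam \<omega> z \<sigma> = lam * (\<Sum>m. (1 - lam) ^ m * stage_payoff g \<sigma> \<omega> z m)"

definition value_N ::
  "'w measure \<Rightarrow> ('w \<Rightarrow> int \<Rightarrow> act \<Rightarrow> real) \<Rightarrow> nat \<Rightarrow> 'w \<Rightarrow> int \<Rightarrow> real" where
  "value_N M g N \<omega> z = (SUP \<sigma> \<in> Collect (strategy M g). payoff_N g N \<omega> z \<sigma>)"

definition value_disc ::
  "'w measure \<Rightarrow> ('w \<Rightarrow> int \<Rightarrow> act \<Rightarrow> real) \<Rightarrow> real \<Rightarrow> 'w \<Rightarrow> int \<Rightarrow> real" where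
  "value_disc M g lam \<omega> z = (SUP \<sigma> \<in> Collect (strategy M g). payoff_disc g lam \<omega> z \<sigma>)"

definition optimal_N ::
  "'w measure \<Rightarrow> ('w \<Rightarrow> int \<Rightarrow> act \<Rightarrow> real) \<Rightarrow> nat \<Rightarrow> 'w strat \<Rightarrow> bool" where
  "optimal_N M g N \<sigma> \<longleftrightarrow> strategy M g \<sigma> \<and>
     (\<forall>\<omega>\<in>space M. \<forall>z. payoff_N g N \<omega> z \<sigma> = value_N M g N \<omega> z)"

definition optimal_disc ::
  "'w measure \<Rightarrow> ('w \<Rightarrow> int \<Rightarrow> act \<Rightarrow> real) \<Rightarrow> real \<Rightarrow> 'w strat \<Rightarrow> bool" where
  "optimal_disc M g lam \<sigma> \<longleftrightarrow> strategy M g \<sigma> \<and>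
     (AE \<omega> in M. \<forall>z. payoff_disc g lam \<omega> z \<sigma> = value_disc M g lam \<omega> z)"

definition is_limit_value ::
  "'w measure \<Rightarrow> ('w \<Rightarrow> int \<Rightarrow> act \<Rightarrow> real) \<Rightarrow> real \<Rightarrow> bool" where
  "is_limit_value M g v \<longleftrightarrow>
     (\<forall>z. AE \<omega> in M. (\<lambda>N. value_N M g N \<omega> z) \<longlonglongrightarrow> v)"

definition is_uniform_value ::
  "'w measure \<Rightarrow> ('w \<Rightarrow> int \<Rightarrow> act \<Rightarrow> real) \<Rightarrow> real \<Rightarrow> bool" where
  "is_uniform_value M g v \<longleftrightarrow> is_limit_value M g v \<and>
     (\<forall>\<epsilon>>0. \<exists>\<sigma>. strategy M g \<sigma> \<and>
        (AE \<omega> in M. \<forall>z. \<forall>\<^sub>F N in sequentially. payoff_N g N \<omega> z \<sigma> \<ge> v - \<epsilon>))"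

(* Below, h is one realization of the payoffs.  pattern h z k c d: the payoffs read from z are
   a, a, 0, (1, 0) k times, c, d for some a, in the order
   (z, +1), (z, +2), (z+1, +1), (z+1, +2), (z+2, +1), ... *)

definition pattern :: "(int \<Rightarrow> act \<Rightarrow> real) \<Rightarrow> int \<Rightarrow> nat \<Rightarrow> real \<Rightarrow> real \<Rightarrow> bool" where
  "pattern h z k c d \<longleftrightarrow>
     h z Plus1 = h z Plus2 \<and> h (z + 1) Plus1 = 0 \<and>
     (\<forall>j\<in>{1..k}. h (z + int j) Plus2 = 1 \<and> h (z + int j + 1) Plus1 = 0) \<and>
     h (z + int k + 1) Plus2 = c \<and> h (z + int k + 2) Plus1 = d"

(* The action i is allowed at state z with n stages remaining; n = \<infinity> gives the rule in
   which the parity clause always applies.  Where no clause applies, in particular if n < k or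
   if the block (1, 0) repeats forever, both actions are allowed. *)

definition star_rule :: "enat \<Rightarrow> (int \<Rightarrow> act \<Rightarrow> real) \<Rightarrow> int \<Rightarrow> act \<Rightarrow> bool" where
  "star_rule n h z i \<longleftrightarrow>
     (h z Plus1 = 0 \<and> h z Plus2 = 1 \<longrightarrow> i = Plus2) \<and>
     (h z Plus1 = 1 \<and> h z Plus2 = 0 \<longrightarrow> i = Plus1) \<and>
     (h z Plus1 = h z Plus2 \<and> h (z + 1) Plus1 = 1 \<longrightarrow> i = Plus1) \<and>
     (\<forall>k c d. pattern h z k c d \<and> (c, d) \<noteq> (1, 0) \<longrightarrow>
        (n \<ge> enat k \<and> even k \<longrightarrow> i = Plus2) \<and>
        (n \<ge> enat k \<and> odd k \<longrightarrow> i = Plus1))"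

(* The two actions need not be equivalent for every n < k.  They are if n <= k/2 + 1, where only
   payoffs inside the block (1, 0)^k matter.  But take n = 4, k = 5, c = 0: +1 collects a + 3 by
   visiting z+1, z+3, z+5, whereas +2 collects at most a + 2.  Hence in the remaining range
   k/2 + 1 < n < k the tie is broken by the parity clause. *)

definition tie_break :: "enat \<Rightarrow> (int \<Rightarrow> act \<Rightarrow> real) \<Rightarrow> int \<Rightarrow> act \<Rightarrow> bool" where
  "tie_break n h z i \<longleftrightarrow>
     (\<forall>k c d. pattern h z k c d \<and> (c, d) \<noteq> (1, 0) \<and> n < enat k \<and> enat (k + 2) < 2 * n \<longrightarrow>
        i = (if even k then Plus2 else Plus1))"

(* sigma obeys the rule R (a condition on the remaining number of stages, the payoffs, the
   current state and the action) throughout the process with n stages; \<infinity> - enat m = \<infinity>. *)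

definition obeys ::
  "'w measure \<Rightarrow> ('w \<Rightarrow> int \<Rightarrow> act \<Rightarrow> real) \<Rightarrow>
   (enat \<Rightarrow> (int \<Rightarrow> act \<Rightarrow> real) \<Rightarrow> int \<Rightarrow> act \<Rightarrow> bool) \<Rightarrow> enat \<Rightarrow> 'w strat \<Rightarrow> bool" where
  "obeys M g R n \<sigma> \<longleftrightarrow>
     (\<forall>\<omega>\<in>space M. \<forall>z m. enat m < n \<longrightarrow> R (n - enat m) (g \<omega>) (state \<sigma> \<omega> z m) (\<sigma> m \<omega> z))"

end

theory Submission
  imports Defs
begin

text \<open>Optimality is deterministic. For states \<open>y\<close> and \<open>y + 1\<close> the dynamic programming values differ by at most 1,
  so a payoff 1 should never be passed up in favour of a payoff 0; when both payoffs at \<open>z\<close> agree, the action is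
  decided by comparing the values at \<open>z + 1\<close> and \<open>z + 2\<close>. If a block \<open>(1 0)^k\<close> follows, both
  values collect the 1's of the block by jumps of length 2, which reduces \<open>k\<close> to \<open>k - 2\<close>; hence the parity
  rule.

  For the limit value, charge \<open>v\<close> per step and let \<open>U n\<close> be the maximal net payoff of a path covering distance
  \<open>n\<close>. Its increments form a Markov chain with four states, and \<open>v\<close> is chosen such that they have
  stationary mean 0. By the Poisson equation \<open>U\<close> is then a bounded perturbation of a martingale with bounded
  increments, so \<open>U n / n\<close> tends to 0 almost surely, while the \<open>N\<close>-stage total payoff equals \<open>v N\<close>
  up to values of \<open>U\<close> at distances at most \<open>2 N\<close>.\<close>

section \<open>Dynamic programming and the parity rule\<close>

text \<open>Total payoff with stage weights \<open>b ^ m\<close>, so that one recursion serves both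
  criteria: \<open>b = 1\<close> for \<open>n\<close> stages, \<open>b = 1 - lam\<close> for the
  truncated discounted sum without its factor \<open>lam\<close>.\<close>

primrec dp_value :: "real \<Rightarrow> nat \<Rightarrow> (int \<Rightarrow> act \<Rightarrow> real) \<Rightarrow> int \<Rightarrow> real" where
  "dp_value b 0 h z = 0"
| "dp_value b (Suc n) h z =
     max (h z Plus1 + b * dp_value b n h (z + 1)) (h z Plus2 + b * dp_value b n h (z + 2))"

declare dp_value.simps(2) [simp del]

lemma dp_value_ge: "h z i + b * dp_value b n h (z + jump i) \<le> dp_value b (Suc n) h z"
  by (cases i) (auto simp: dp_value.simps)

lemma int_add_1_1: "(z::int) + 1 + 1 = z + 2"
  and int_add_1_2: "(z::int) + 1 + 2 = z + 3"
  and int_add_2_1: "(z::int) + 2 + 1 = z + 3"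
  by simp_all

lemmas int_add_assoc = int_add_1_1 int_add_1_2 int_add_2_1

section \<open>Values for a fixed realization of the payoffs\<close>

locale payoff_field =
  fixes h :: "int \<Rightarrow> act \<Rightarrow> real" and b :: real
  assumes payoff_range: "h z i \<in> {0, 1}"
    and discount_range: "0 \<le> b" "b \<le> 1"
begin

abbreviation V :: "nat \<Rightarrow> int \<Rightarrow> real" where
  "V n z \<equiv> dp_value b n h z"

lemma payoff_cases: obtains "h z i = 0" | "h z i = 1"
  using payoff_range[of z i] by auto

lemma payoff_ge_0: "0 \<le> h z i" and payoff_le_1: "h z i \<le> 1"
  using payoff_range[of z i] by auto

lemma V_Suc_ge: "b * V n (z + 1) \<le> V (Suc n) z" "b * V n (z + 2) \<le> V (Suc n) z"
  using payoff_ge_0[of z Plus1] payoff_ge_0[of z Plus2] by (auto simp: dp_value.simps)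

lemma V_mono_horizon: "V n z \<le> V (Suc n) z"
proof (induction n arbitrary: z)
  case 0
  then show ?case using payoff_ge_0[of z Plus1] by (auto simp: dp_value.simps)
next
  case (Suc n)
  have "b * V n (z + 1) \<le> b * V (Suc n) (z + 1)" "b * V n (z + 2) \<le> b * V (Suc n) (z + 2)"
    using Suc discount_range by (auto intro: mult_left_mono)
  then show ?case
    unfolding dp_value.simps(2)[of b n h z] dp_value.simps(2)[of b "Suc n" h z]
    by (intro max.mono add_left_mono)
qed

lemma V_nonneg: "0 \<le> V n z"
proof (induction n)
  case (Suc n)
  then show ?case using V_mono_horizon[of n z] by linarith
qed simp

text \<open>If the play from \<open>z\<close> starts with +1, dropping that stage loses at most 1;
  if it starts with +2, the play from \<open>z + 1\<close> reaches \<open>z + 2\<close> by +1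
  instead.\<close>

lemma V_le_V_next: "V n z \<le> 1 + V n (z + 1)"
proof (cases n)
  case (Suc m)
  have "b * V m (z + 1) \<le> V m (z + 1)"
    using V_nonneg discount_range by (simp add: mult_left_le_one_le)
  also have "\<dots> \<le> V n (z + 1)"
    unfolding Suc by (rule V_mono_horizon)
  finally have "h z Plus1 + b * V m (z + 1) \<le> 1 + V n (z + 1)"
    using payoff_le_1[of z Plus1] by linarith
  moreover have "h z Plus2 + b * V m (z + 2) \<le> 1 + V n (z + 1)"
    using payoff_le_1[of z Plus2] V_Suc_ge(1)[of m "z + 1"]
    unfolding Suc int_add_assoc by linarith
  ultimately show ?thesis unfolding Suc by (simp add: dp_value.simps)
qed simp

text \<open>Delay a play by one stage behind a payoff 1 and drop its last stage: as the weights do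
  not increase, nothing is lost. The induction rests on
  \<open>(1 - h z i) * (1 - b) >= 0\<close>.\<close>

lemma V_Suc_le: "V (Suc n) z \<le> 1 + b * V n z"
proof (induction n arbitrary: z)
  case 0
  then show ?case using payoff_le_1[of z] by (simp add: dp_value.simps)
next
  case (Suc n)
  have *: "b * V (Suc n) (z + j) \<le> b + b * (b * V n (z + j))" for j
    using mult_left_mono[OF Suc discount_range(1)] by (simp add: algebra_simps)
  have **: "b * (h z i + b * V n (z + jump i)) \<le> b * V (Suc n) z" for i
    by (intro mult_left_mono dp_value_ge discount_range)
  have ***: "h z i + b \<le> 1 + b * h z i" for i
    using discount_range by (cases rule: payoff_cases[of z i]) auto
  have "h z i + b * V (Suc n) (z + jump i) \<le> 1 + b * V (Suc n) z" for i
    using *[of "jump i"] **[of i] ***[of i] by (simp only: distrib_left)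
  from this[of Plus1] this[of Plus2] show ?case
    unfolding dp_value.simps(2)[of b "Suc n" h z] by simp
qed

text \<open>From \<open>z\<close>, go to \<open>z + 1\<close> by +1; the stage spent on this is
  worth at most 1 by \<open>V_Suc_le\<close>.\<close>

lemma V_next_le_V: "V n (z + 1) \<le> 1 + V n z"
proof (cases n)
  case (Suc m)
  have "V n (z + 1) \<le> 1 + b * V m (z + 1)"
    unfolding Suc by (rule V_Suc_le)
  then show ?thesis
    using V_Suc_ge(1)[of m z] unfolding Suc by linarith
qed simp

text \<open>Here the payoff of the edge to \<open>z + 1\<close> makes up for the stage spent.
  Applied at \<open>z + 1\<close>, this gives the clause of the rule with a payoff 1 there.\<close>

lemma V_next_le_V_if_payoff:
  assumes "h z Plus1 = 1"
  shows "V n (z + 1) \<le> V n z"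
proof (cases n)
  case (Suc m)
  have "V n (z + 1) \<le> 1 + b * V m (z + 1)"
    unfolding Suc by (rule V_Suc_le)
  also have "\<dots> \<le> V n z"
    unfolding Suc using assms by (simp add: dp_value.simps)
  finally show ?thesis .
qed simp

text \<open>Passing up the payoff costs 1 now, while the other continuation is ahead by at most
  \<open>b\<close>.\<close>

lemma V_Suc_eq_Plus2:
  assumes "h z Plus1 = 0" "h z Plus2 = 1"
  shows "V (Suc n) z = 1 + b * V n (z + 2)"
proof -
  have "b * V n (z + 1) \<le> b * (1 + V n (z + 2))"
    using V_le_V_next[of n "z + 1", unfolded int_add_assoc] discount_range by (intro mult_left_mono)
  also have "\<dots> \<le> 1 + b * V n (z + 2)"
    using discount_range by (simp add: algebra_simps)
  finally show ?thesis using assms by (simp add: dp_value.simps)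
qed

lemma V_Suc_eq_Plus1:
  assumes "h z Plus1 = 1" "h z Plus2 = 0"
  shows "V (Suc n) z = 1 + b * V n (z + 1)"
proof -
  have "b * V n (z + 2) \<le> b * (1 + V n (z + 1))"
    using V_next_le_V[of n "z + 1", unfolded int_add_assoc] discount_range by (intro mult_left_mono)
  also have "\<dots> \<le> 1 + b * V n (z + 1)"
    using discount_range by (simp add: algebra_simps)
  finally show ?thesis using assms by (simp add: dp_value.simps)
qed

text \<open>The part \<open>0 (1 0)^k\<close> of the pattern, read from \<open>y = z + 1\<close>.
  What follows is left open, so that initial pieces of longer or endless repetitions qualify
  too.\<close>

definition block :: "int \<Rightarrow> nat \<Rightarrow> bool" where
  "block y k \<longleftrightarrow> h y Plus1 = 0 \<and>
     (\<forall>j<k. h (y + int j) Plus2 = 1 \<and> h (y + int j + 1) Plus1 = 0)"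

lemma block_shift:
  assumes "block y k" "i \<le> k"
  shows "block (y + int i) (k - i)"
proof -
  have "h (y + int i) Plus1 = 0"
    using assms by (cases i) (auto simp: block_def add_ac)
  moreover have "h (y + int i + int j) Plus2 = 1 \<and> h (y + int i + int j + 1) Plus1 = 0"
    if "j < k - i" for j
    using assms that unfolding block_def
    by (auto dest!: spec[of _ "i + j"] simp: add_ac)
  ultimately show ?thesis by (auto simp: block_def)
qed

lemma block_Plus1: "block y k \<Longrightarrow> j \<le> k \<Longrightarrow> h (y + int j) Plus1 = 0"
  by (cases j) (auto simp: block_def add_ac)

lemma block_Plus2: "block y k \<Longrightarrow> j < k \<Longrightarrow> h (y + int j) Plus2 = 1"
  by (auto simp: block_def)

text \<open>The jumps +2 use the edges at \<open>y, ..., y + 2 * (n - 1)\<close>; the bound says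
  that the last of them still belongs to the block, so every stage pays 1.\<close>

lemma V_in_block:
  assumes "block y k" "2 * n \<le> Suc k"
  shows "V n y = (\<Sum>m<n. b ^ m)"
  using assms
proof (induction n arbitrary: y k)
  case (Suc n)
  have "h y Plus1 = 0" "h y Plus2 = 1"
    using block_Plus1[OF Suc.prems(1), of 0] block_Plus2[OF Suc.prems(1), of 0] Suc.prems(2) by auto
  then have V: "V (Suc n) y = 1 + b * V n (y + 2)"
    by (rule V_Suc_eq_Plus2)
  show ?case
  \<comment> \<open>With one stage left \<open>k\<close> may be 1, and then a shift by 2 leaves the
    block.\<close>
  proof (cases n)
    case 0
    then show ?thesis using V by simp
  next
    case (Suc n')
    have "block (y + int 2) (k - 2)"
      by (rule block_shift[OF Suc.prems(1)]) (use Suc Suc.prems(2) in auto)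
    then have "V n (y + int 2) = (\<Sum>m<n. b ^ m)"
      by (rule Suc.IH) (use Suc.prems(2) in auto)
    then show ?thesis
      unfolding V by (simp add: sum.lessThan_Suc_shift sum_distrib_left del: sum.lessThan_Suc)
  qed
qed simp

text \<open>For \<open>k >= 2\<close> the paying +2 is optimal from both states, which leaves the
  same comparison at \<open>y + 2\<close> with \<open>k - 2\<close> and one stage fewer. The base
  cases \<open>k = 0\<close> and \<open>k = 1\<close> depend on how the block ends.\<close>

lemma V_parity:
  assumes "block y k" and end_block: "\<not> (h (y + int k) Plus2 = 1 \<and> h (y + int k + 1) Plus1 = 0)"
  shows "if even k then V n y \<le> V n (y + 1) else V n (y + 1) \<le> V n y"
  using assms
proof (induction k arbitrary: y n rule: less_induct)
  case (less k)
  show ?case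
  proof (cases n)
    case (Suc m)
    have y0: "h y Plus1 = 0"
      using less.prems(1) by (simp add: block_def)
    consider "k = 0" | "k = 1" | "2 \<le> k" by linarith
    then show ?thesis
    proof cases
      case 1
      \<comment> \<open>Either no edge leaving \<open>y\<close> pays, or \<open>y + 1\<close>
        reaches \<open>y + 2\<close> by an edge that pays as much as the jump from
        \<open>y\<close>.\<close>
      consider "h y Plus2 = 0" | "h y Plus2 = 1" "h (y + 1) Plus1 = 1"
        using less.prems(2) 1 payoff_range[of y Plus2] payoff_range[of "y + 1" Plus1] by auto
      then have "V (Suc m) y \<le> V (Suc m) (y + 1)"
      proof cases
        case 1
        have "b * V m (y + 1) \<le> V m (y + 1)"
          using V_nonneg discount_range by (simp add: mult_left_le_one_le)
        then have "b * V m (y + 1) \<le> V (Suc m) (y + 1)"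
          using V_mono_horizon[of m "y + 1"] by linarith
        moreover have "b * V m (y + 2) \<le> V (Suc m) (y + 1)"
          using V_Suc_ge(1)[of m "y + 1", unfolded int_add_assoc] .
        ultimately show ?thesis
          unfolding dp_value.simps(2)[of b m h y] using y0 1 by simp
      next
        case 2
        then show ?thesis
          using dp_value_ge[of h "y + 1" Plus1 b m] V_Suc_eq_Plus2[OF y0]
          by (simp add: int_add_assoc)
      qed
      then show ?thesis using 1 Suc by simp
    next
      case 2
      have V: "V (Suc m) y = 1 + b * V m (y + 2)"
        using y0 block_Plus2[OF less.prems(1), of 0] 2 by (intro V_Suc_eq_Plus2) auto
      have y1: "h (y + 1) Plus1 = 0"
        using block_Plus1[OF less.prems(1), of 1] 2 by simp
      have "\<not> (h (y + 1) Plus2 = 1 \<and> h (y + 2) Plus1 = 0)"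
        using less.prems(2) 2 by (simp add: int_add_assoc)
      then consider "h (y + 1) Plus2 = 0" | "h (y + 1) Plus2 = 1" "h (y + 2) Plus1 = 1"
        using payoff_range[of "y + 1" Plus2] payoff_range[of "y + 2" Plus1] by auto
      \<comment> \<open>Either the jump to \<open>y + 3\<close> pays 0 and \<open>y + 3\<close> is
        ahead of \<open>y + 2\<close> by at most 1, or the edge from \<open>y + 2\<close> to
        \<open>y + 3\<close> pays 1 and \<open>y + 2\<close> is at least as good.\<close>
      then have "h (y + 1) Plus2 + b * V m (y + 3) \<le> 1 + b * V m (y + 2)"
      proof cases
        case 1
        have "b * V m (y + 3) \<le> b * (1 + V m (y + 2))"
          using V_next_le_V[of m "y + 2", unfolded int_add_assoc] discount_range by (intro mult_left_mono)
        then show ?thesis using 1 discount_range by (simp add: algebra_simps)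
      next
        case 2
        then show ?thesis
          using V_next_le_V_if_payoff[of "y + 2" m, unfolded int_add_assoc] discount_range
          by (simp add: mult_left_mono)
      qed
      then have "V (Suc m) (y + 1) \<le> V (Suc m) y"
        unfolding V using y1 V_nonneg[of m "y + 2"] discount_range
        by (simp add: dp_value.simps int_add_assoc)
      then show ?thesis using 2 Suc by simp
    next
      case 3
      have y1: "V (Suc m) (y + 1) = 1 + b * V m (y + 3)"
        using V_Suc_eq_Plus2[of "y + 1" m] block_Plus1[OF less.prems(1), of 1]
          block_Plus2[OF less.prems(1), of 1] 3 by (simp add: int_add_assoc)
      have y2: "V (Suc m) y = 1 + b * V m (y + 2)"
        using y0 block_Plus2[OF less.prems(1), of 0] 3 by (intro V_Suc_eq_Plus2) auto
      have "block (y + 2) (k - 2)"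
        using block_shift[OF less.prems(1) 3] by simp
      then have "if even (k - 2) then V m (y + 2) \<le> V m (y + 2 + 1) else V m (y + 2 + 1) \<le> V m (y + 2)"
        using less.prems(2) 3 by (intro less.IH) (auto simp: of_nat_diff)
      then show ?thesis
        using 3 discount_range unfolding Suc y1 y2
        by (auto intro: mult_left_mono simp: int_add_assoc split: if_splits)
    qed
  qed simp
qed

text \<open>Discounting leaves the rule unchanged: the parity inequality holds for every horizon and
  every discount factor, so the bounds on \<open>n\<close> only serve to skip the cases where both actions
  are equivalent.\<close>

lemma rule_attains_V:
  assumes "star_rule (enat (Suc n)) h z i" "tie_break (enat (Suc n)) h z i"
  shows "h z i + b * V n (z + jump i) = V (Suc n) z"
proof (cases "h z Plus1 = h z Plus2")
  case False
  then consider "h z Plus1 = 0" "h z Plus2 = 1" | "h z Plus1 = 1" "h z Plus2 = 0"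
    using payoff_range[of z Plus1] payoff_range[of z Plus2] by auto
  then show ?thesis
  proof cases
    case 1
    then have "i = Plus2" using assms(1) by (simp add: star_rule_def)
    then show ?thesis using V_Suc_eq_Plus2[OF 1] 1 by simp
  next
    case 2
    then have "i = Plus1" using assms(1) by (simp add: star_rule_def)
    then show ?thesis using V_Suc_eq_Plus1[OF 2] 2 by simp
  qed
next
  case True
  have Plus1: ?thesis if "i = Plus1" "V n (z + 2) \<le> V n (z + 1)"
    using that True discount_range by (auto simp: dp_value.simps mult_left_mono max_absorb1)
  have Plus2: ?thesis if "i = Plus2" "V n (z + 1) \<le> V n (z + 2)"
    using that True discount_range by (auto simp: dp_value.simps mult_left_mono max_absorb2)
  have equal: ?thesis if "V n (z + 1) = V n (z + 2)"
    using that True by (cases i) (auto simp: dp_value.simps)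
  show ?thesis
  proof (cases "h (z + 1) Plus1 = 1")
    case t: True
    then have "i = Plus1" using assms(1) True by (simp add: star_rule_def)
    then show ?thesis
      using Plus1 V_next_le_V_if_payoff[OF t, of n] by (simp add: int_add_assoc)
  next
    case False
    then have z1: "h (z + 1) Plus1 = 0"
      using payoff_range[of "z + 1" Plus1] by auto
    \<comment> \<open>With so short a horizon both states collect 1 at every stage. The block from
      \<open>z + 2\<close> has length \<open>k - 1\<close> only, whence
      \<open>2 * n <= k\<close>.\<close>
    have V_equal: "V n (z + 1) = V n (z + 2)" if "block (z + 1) k" "2 * n \<le> k" for k
    proof (cases "n = 0")
      case n: False
      have "block (z + 1 + int 1) (k - 1)"
        using that n by (intro block_shift) auto
      then have "V n (z + 1 + int 1) = (\<Sum>m<n. b ^ m)"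
        by (rule V_in_block) (use that n in auto)
      then show ?thesis
        using V_in_block[OF that(1)] that(2) by (simp add: int_add_assoc)
    qed simp
    show ?thesis
    proof (cases "\<exists>k. \<not> (h (z + 1 + int k) Plus2 = 1 \<and> h (z + 1 + int k + 1) Plus1 = 0)")
      case True
      \<comment> \<open>Leastness gives the block, and the failure at \<open>k\<close> gives the
        condition on \<open>(c, d)\<close>.\<close>
      define k where "k = (LEAST k. \<not> (h (z + 1 + int k) Plus2 = 1 \<and> h (z + 1 + int k + 1) Plus1 = 0))"
      have k: "\<not> (h (z + 1 + int k) Plus2 = 1 \<and> h (z + 1 + int k + 1) Plus1 = 0)"
        unfolding k_def using True by (rule LeastI_ex)
      have block: "block (z + 1) k"
        unfolding block_def k_def using z1 not_less_Least by blast
      have "pattern h z k (h (z + int k + 1) Plus2) (h (z + int k + 2) Plus1)"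
        unfolding pattern_def
      proof (intro conjI ballI)
        fix j assume "j \<in> {1..k}"
        then have "j - 1 < k" and j: "z + 1 + int (j - 1) = z + int j" by auto
        then show "h (z + int j) Plus2 = 1" "h (z + int j + 1) Plus1 = 0"
          using block unfolding block_def j[symmetric] by blast+
      qed (use \<open>h z Plus1 = h z Plus2\<close> z1 in auto)
      moreover have "(h (z + int k + 1) Plus2, h (z + int k + 2) Plus1) \<noteq> (1, 0)"
        using k by (simp add: algebra_simps)
      ultimately obtain c d where cd: "pattern h z k c d \<and> (c, d) \<noteq> (1, 0)"
        by blast
      \<comment> \<open>With \<open>n + 1\<close> stages remaining, \<open>star_rule\<close> fixes
        the action for \<open>k <= n + 1\<close>; beyond that \<open>tie_break\<close> does so, its
        bound being equivalent to \<open>k < 2 * n\<close>.\<close>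
      have i: "i = (if even k then Plus2 else Plus1)" if "k < 2 * n"
      proof (cases "k \<le> Suc n")
        case True
        then have "enat k \<le> enat (Suc n)" by simp
        with cd assms(1) show ?thesis
          unfolding star_rule_def by (simp only: split: if_split) blast
      next
        case False
        then have "enat (Suc n) < enat k" by simp
        moreover have "enat (k + 2) < 2 * enat (Suc n)"
          using that by (simp add: numeral_eq_enat)
        ultimately show ?thesis
          using cd assms(2) unfolding tie_break_def by blast
      qed
      show ?thesis
      proof (cases "2 * n \<le> k")
        case True
        then show ?thesis using equal V_equal[OF block] by blast
      next
        case False
        then show ?thesis
          using i V_parity[OF block k, of n, unfolded int_add_assoc] Plus1 Plus2
          by (auto split: if_splits)
      qed
    next
      case False
      \<comment> \<open>In an endless repetition every length is available; \<open>2 * n\<close>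
        suffices for equal values.\<close>
      then have "block (z + 1) (2 * n)" using z1 by (auto simp: block_def)
      then show ?thesis using equal V_equal by blast
    qed
  qed
qed

end

lemma star_rule_infinity:
  assumes "star_rule \<infinity> h z i"
  shows "star_rule n h z i" "tie_break n h z i"
  using assms by (auto simp: star_rule_def tie_break_def)

section \<open>Strategies\<close>

lemma (in pmdp) payoff_field:
  "\<omega> \<in> space M \<Longrightarrow> 0 \<le> b \<Longrightarrow> b \<le> 1 \<Longrightarrow> payoff_field (g \<omega>) b"
  using payoff_01 by unfold_locales auto

text \<open>The last stage is absorbed into the continuation value, so \<open>k\<close> varies in
  the induction. Peeling off the first stage would change the initial state, on which the strategy
  depends.\<close>

lemma discounted_sum_le:
  assumes "0 \<le> b"
  shows "(\<Sum>m<n. b ^ m * stage_payoff g \<sigma> \<omega> z m) + b ^ n * dp_value b k (g \<omega>) (state \<sigma> \<omega> z n)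
    \<le> dp_value b (n + k) (g \<omega>) z"
proof (induction n arbitrary: k)
  case (Suc n)
  have "b ^ n * (stage_payoff g \<sigma> \<omega> z n + b * dp_value b k (g \<omega>) (state \<sigma> \<omega> z (Suc n)))
      \<le> b ^ n * dp_value b (Suc k) (g \<omega>) (state \<sigma> \<omega> z n)"
    using assms by (intro mult_left_mono) (auto simp: stage_payoff_def dp_value_ge)
  then show ?case using Suc[of "Suc k"] by (simp add: algebra_simps)
qed simp

lemma discounted_sum_eq:
  assumes "\<And>m. m < n \<Longrightarrow>
    g \<omega> (state \<sigma> \<omega> z m) (\<sigma> m \<omega> z) + b * dp_value b (n + k - Suc m) (g \<omega>) (state \<sigma> \<omega> z (Suc m))
      = dp_value b (n + k - m) (g \<omega>) (state \<sigma> \<omega> z m)"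
  shows "(\<Sum>m<n. b ^ m * stage_payoff g \<sigma> \<omega> z m) + b ^ n * dp_value b k (g \<omega>) (state \<sigma> \<omega> z n)
    = dp_value b (n + k) (g \<omega>) z"
  using assms
proof (induction n arbitrary: k)
  case (Suc n)
  have "(\<Sum>m<n. b ^ m * stage_payoff g \<sigma> \<omega> z m)
      + b ^ n * dp_value b (Suc k) (g \<omega>) (state \<sigma> \<omega> z n) = dp_value b (n + Suc k) (g \<omega>) z"
    by (rule Suc.IH) (use Suc.prems in auto)
  moreover have "stage_payoff g \<sigma> \<omega> z n + b * dp_value b k (g \<omega>) (state \<sigma> \<omega> z (Suc n))
      = dp_value b (Suc k) (g \<omega>) (state \<sigma> \<omega> z n)"
    using Suc.prems[of n] by (simp add: stage_payoff_def Suc_diff_le)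
  then have "b ^ n * dp_value b (Suc k) (g \<omega>) (state \<sigma> \<omega> z n)
      = b ^ n * stage_payoff g \<sigma> \<omega> z n + b ^ Suc n * dp_value b k (g \<omega>) (state \<sigma> \<omega> z (Suc n))"
    by (metis distrib_left mult.assoc power_Suc2)
  ultimately show ?case by simp
qed simp

section \<open>A measurable strategy following the parity rule\<close>

lemma pattern_unique:
  assumes "pattern h z k c d" "(c, d) \<noteq> (1, 0)" "pattern h z k' c' d'" "(c', d') \<noteq> (1, 0)"
  shows "k = k'"
proof -
  have False if "pattern h z k c d" "(c, d) \<noteq> (1, 0)" "pattern h z k' c' d'" "k < k'" for k c d k' c' d'
  proof -
    have "Suc k \<in> {1..k'}" using that(4) by simp
    then have "h (z + int (Suc k)) Plus2 = 1 \<and> h (z + int (Suc k) + 1) Plus1 = 0"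
      using that(3) unfolding pattern_def by blast
    then show False using that(1,2) by (simp add: pattern_def add_ac)
  qed
  then show ?thesis using assms by (meson linorder_neqE_nat)
qed

text \<open>Reading \<open>c\<close> and \<open>d\<close> off \<open>h\<close> leaves only a
  countable quantifier, as measurability requires. The final \<open>Plus1\<close> covers odd
  \<open>k\<close> and endless blocks.\<close>

definition parity_policy :: "(int \<Rightarrow> act \<Rightarrow> real) \<Rightarrow> int \<Rightarrow> act" where
  "parity_policy h z =
     (if h z Plus1 = 0 \<and> h z Plus2 = 1 then Plus2
      else if h z Plus1 = 1 \<and> h z Plus2 = 0 then Plus1
      else if h (z + 1) Plus1 = 1 then Plus1
      else if \<exists>k. even k \<and> pattern h z k (h (z + int k + 1) Plus2) (h (z + int k + 2) Plus1)
                   \<and> \<not> (h (z + int k + 1) Plus2 = 1 \<and> h (z + int k + 2) Plus1 = 0) then Plus2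
      else Plus1)"

lemma star_rule_parity_policy: "star_rule \<infinity> h z (parity_policy h z)"
proof -
  have policy: "parity_policy h z = (if even k then Plus2 else Plus1)"
    if kcd: "pattern h z k c d" "(c, d) \<noteq> (1, 0)" for k c d
  proof -
    have eq: "h z Plus1 = h z Plus2" "h (z + 1) Plus1 = 0"
      using kcd(1) by (auto simp: pattern_def)
    have cd: "c = h (z + int k + 1) Plus2" "d = h (z + int k + 2) Plus1"
      using kcd(1) by (auto simp: pattern_def)
    have ex: "(\<exists>k. even k \<and> pattern h z k (h (z + int k + 1) Plus2) (h (z + int k + 2) Plus1)
                   \<and> \<not> (h (z + int k + 1) Plus2 = 1 \<and> h (z + int k + 2) Plus1 = 0)) = even k"
      (is "(\<exists>k'. ?P k') = _")
    proof
      assume "\<exists>k'. ?P k'"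
      then obtain k' where k': "?P k'" by blast
      then have "k = k'" using pattern_unique[OF kcd] by blast
      then show "even k" using k' by blast
    next
      assume "even k"
      then have "?P k" using kcd unfolding cd by blast
      then show "\<exists>k'. ?P k'" by blast
    qed
    then show ?thesis
      unfolding parity_policy_def ex using eq by auto
  qed
  have "parity_policy h z = Plus2" if "h z Plus1 = 0 \<and> h z Plus2 = 1"
    using that by (simp add: parity_policy_def)
  moreover have "parity_policy h z = Plus1"
    if "h z Plus1 = 1 \<and> h z Plus2 = 0 \<or> h z Plus1 = h z Plus2 \<and> h (z + 1) Plus1 = 1"
    using that by (auto simp: parity_policy_def)
  moreover have "parity_policy h z = Plus2" if "pattern h z k c d" "(c, d) \<noteq> (1, 0)" "even k" for k c d
    using policy[OF that(1,2)] that(3) by simp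
  moreover have "parity_policy h z = Plus1" if "pattern h z k c d" "(c, d) \<noteq> (1, 0)" "odd k" for k c d
    using policy[OF that(1,2)] that(3) by simp
  ultimately show ?thesis
    unfolding star_rule_def by blast
qed

text \<open>A strategy receives the initial state, not the current one, which is therefore
  recomputed.\<close>

primrec parity_state :: "(int \<Rightarrow> act \<Rightarrow> real) \<Rightarrow> int \<Rightarrow> nat \<Rightarrow> int" where
  "parity_state h z 0 = z"
| "parity_state h z (Suc m) = parity_state h z m + jump (parity_policy h (parity_state h z m))"

definition parity_strategy :: "('w \<Rightarrow> int \<Rightarrow> act \<Rightarrow> real) \<Rightarrow> 'w strat" where
  "parity_strategy g m \<omega> z = parity_policy (g \<omega>) (parity_state (g \<omega>) z m)"

lemma state_parity_strategy: "state (parity_strategy g) \<omega> z m = parity_state (g \<omega>) z m"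
  by (induction m) (simp_all add: parity_strategy_def)

context pmdp
begin

lemma space_payoff_algebra [simp]: "space (payoff_algebra M g) = space M"
  unfolding payoff_algebra_def by (rule space_measure_of) blast

lemma measurable_payoff [measurable]: "(\<lambda>\<omega>. g \<omega> z i) \<in> borel_measurable (payoff_algebra M g)"
proof (rule measurableI)
  let ?G = "{(\<lambda>\<omega>. g \<omega> z i) -` B \<inter> space M | z i B. B \<in> sets borel}"
  fix B :: "real set" assume "B \<in> sets borel"
  then have "(\<lambda>\<omega>. g \<omega> z i) -` B \<inter> space M \<in> ?G" by blast
  then have "(\<lambda>\<omega>. g \<omega> z i) -` B \<inter> space M \<in> sigma_sets (space M) ?G"
    by (rule sigma_sets.Basic)
  moreover have "sets (sigma (space M) ?G) = sigma_sets (space M) ?G"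
    by (rule sets_measure_of) blast
  ultimately show "(\<lambda>\<omega>. g \<omega> z i) -` B \<inter> space (payoff_algebra M g) \<in> sets (payoff_algebra M g)"
    unfolding space_payoff_algebra unfolding payoff_algebra_def by blast
qed (simp only: space_borel UNIV_I)

lemma measurable_pattern:
  assumes [measurable]: "c \<in> borel_measurable (payoff_algebra M g)" "d \<in> borel_measurable (payoff_algebra M g)"
  shows "Measurable.pred (payoff_algebra M g) (\<lambda>\<omega>. pattern (g \<omega>) z k (c \<omega>) (d \<omega>))"
  unfolding pattern_def by measurable

lemma measurable_parity_policy:
  "(\<lambda>\<omega>. parity_policy (g \<omega>) z) \<in> payoff_algebra M g \<rightarrow>\<^sub>M count_space UNIV"
proof -
  have even_block: "Measurable.pred (payoff_algebra M g) (\<lambda>\<omega>. \<exists>k. even k \<and>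
      pattern (g \<omega>) z k (g \<omega> (z + int k + 1) Plus2) (g \<omega> (z + int k + 2) Plus1) \<and>
      \<not> (g \<omega> (z + int k + 1) Plus2 = 1 \<and> g \<omega> (z + int k + 2) Plus1 = 0))"
    by (intro pred_intros_countable pred_intros_logic measurable_pattern) measurable
  show ?thesis
    unfolding parity_policy_def
    by (intro measurable_If measurable_const even_block[unfolded pred_def]) measurable
qed

lemma measurable_parity_state:
  "(\<lambda>\<omega>. parity_state (g \<omega>) z m) \<in> payoff_algebra M g \<rightarrow>\<^sub>M count_space UNIV"
proof (induction m)
  case (Suc m)
  have "(\<lambda>\<omega>. y + jump (parity_policy (g \<omega>) y)) \<in> payoff_algebra M g \<rightarrow>\<^sub>M count_space UNIV" for y
    by (rule measurable_compose[OF measurable_parity_policy]) simp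
  from measurable_compose_countable[OF this Suc] show ?case by simp
qed simp

lemma strategy_parity_strategy: "strategy M g (parity_strategy g)"
  unfolding strategy_def
proof
  fix m
  \<comment> \<open>As there are countably many states, measurability for each fixed
    \<open>z\<close> suffices.\<close>
  have "(\<lambda>\<omega>. parity_strategy g m \<omega> z) \<in> payoff_algebra M g \<rightarrow>\<^sub>M count_space UNIV" for z
    unfolding parity_strategy_def
    by (rule measurable_compose_countable[OF measurable_parity_policy measurable_parity_state])
  then show "(\<lambda>(\<omega>, z). parity_strategy g m \<omega> z)
      \<in> payoff_algebra M g \<Otimes>\<^sub>M count_space UNIV \<rightarrow>\<^sub>M count_space UNIV"
    unfolding case_prod_beta
    by (intro measurable_compose_countable[where f = "\<lambda>z x. parity_strategy g m (fst x) z" and g = snd]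
        measurable_compose[OF measurable_fst] measurable_snd)
qed

end

lemma obeys_parity_strategy: "obeys M g star_rule \<infinity> (parity_strategy g)"
  unfolding obeys_def state_parity_strategy
  by (simp add: parity_strategy_def star_rule_parity_policy)

lemma obeys_infinity_imp:
  assumes "obeys M g star_rule \<infinity> \<sigma>"
  shows "obeys M g star_rule n \<sigma>" "obeys M g tie_break n \<sigma>"
proof -
  have "star_rule \<infinity> (g \<omega>) (state \<sigma> \<omega> z m) (\<sigma> m \<omega> z)" if "\<omega> \<in> space M" for \<omega> z m
    using assms[unfolded obeys_def, rule_format, OF that, where m = m and z = z] by simp
  from star_rule_infinity[OF this] show "obeys M g star_rule n \<sigma>" "obeys M g tie_break n \<sigma>"
    unfolding obeys_def by simp_all
qed

section \<open>Optimality for finite horizons and for discounting\<close>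

context pmdp
begin

lemma rule_discounted_sum:
  assumes "obeys M g star_rule (enat N) \<sigma>" "obeys M g tie_break (enat N) \<sigma>"
    and "\<omega> \<in> space M" "0 \<le> b" "b \<le> 1"
  shows "(\<Sum>m<N. b ^ m * stage_payoff g \<sigma> \<omega> z m) = dp_value b N (g \<omega>) z"
proof -
  interpret payoff_field "g \<omega>" b by (rule payoff_field) fact+
  have attains: "g \<omega> (state \<sigma> \<omega> z m) (\<sigma> m \<omega> z) + b * V (N - Suc m) (state \<sigma> \<omega> z (Suc m))
      = V (N - m) (state \<sigma> \<omega> z m)" if "m < N" for m
  proof -
    have N: "N - m = Suc (N - Suc m)" using that by simp
    have "star_rule (enat (N - m)) (g \<omega>) (state \<sigma> \<omega> z m) (\<sigma> m \<omega> z)"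
      "tie_break (enat (N - m)) (g \<omega>) (state \<sigma> \<omega> z m) (\<sigma> m \<omega> z)"
      using assms(1-3) that unfolding obeys_def by (simp_all only: idiff_enat_enat enat_ord_simps)
    then show ?thesis
      unfolding N state.simps by (rule rule_attains_V)
  qed
  have "(\<Sum>m<N. b ^ m * stage_payoff g \<sigma> \<omega> z m) + b ^ N * V 0 (state \<sigma> \<omega> z N) = V (N + 0) z"
    by (rule discounted_sum_eq) (simp only: add_0_right attains)
  then show ?thesis by simp
qed

lemma discounted_sum_le_dp_value:
  assumes "0 \<le> b"
  shows "(\<Sum>m<N. b ^ m * stage_payoff g \<sigma> \<omega> z m) \<le> dp_value b N (g \<omega>) z"
  using discounted_sum_le[OF assms, of g \<sigma> \<omega> z N 0] by simp

lemma payoff_N_le_dp_value: "payoff_N g N \<omega> z \<sigma> \<le> dp_value 1 N (g \<omega>) z / N"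
  using discounted_sum_le_dp_value[of 1 \<sigma> \<omega> z N] by (simp add: payoff_N_def divide_right_mono)

lemma rule_payoff_N:
  assumes "obeys M g star_rule (enat N) \<sigma>" "obeys M g tie_break (enat N) \<sigma>" "\<omega> \<in> space M"
  shows "payoff_N g N \<omega> z \<sigma> = dp_value 1 N (g \<omega>) z / N"
  using rule_discounted_sum[OF assms, of 1] by (simp add: payoff_N_def)

text \<open>The supremum over measurable strategies is the pointwise optimum because the measurable
  parity strategy attains the latter.\<close>

lemma value_N_eq:
  assumes "\<omega> \<in> space M"
  shows "value_N M g N \<omega> z = dp_value 1 N (g \<omega>) z / N"
  unfolding value_N_def
proof (rule cSup_eq_maximum)
  show "dp_value 1 N (g \<omega>) z / N \<in> payoff_N g N \<omega> z ` Collect (strategy M g)"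
    using rule_payoff_N[OF obeys_infinity_imp[OF obeys_parity_strategy] assms, of N z]
      strategy_parity_strategy
    by (metis image_eqI mem_Collect_eq)
qed (use payoff_N_le_dp_value in auto)

lemma rule_optimal_N:
  assumes "strategy M g \<sigma>" "obeys M g star_rule (enat N) \<sigma>" "obeys M g tie_break (enat N) \<sigma>"
  shows "optimal_N M g N \<sigma>"
  using assms by (simp add: optimal_N_def rule_payoff_N value_N_eq)

lemma summable_discounted:
  assumes "\<omega> \<in> space M" "0 \<le> b" "b < 1"
  shows "summable (\<lambda>m. b ^ m * stage_payoff g \<sigma> \<omega> z m)"
proof (rule summable_comparison_test')
  show "summable (\<lambda>m. b ^ m)" using assms by (simp add: summable_geometric)
  show "norm (b ^ m * stage_payoff g \<sigma> \<omega> z m) \<le> b ^ m" for m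
    using payoff_01[OF assms(1), of "state \<sigma> \<omega> z m" "\<sigma> m \<omega> z"] assms
    by (auto simp: stage_payoff_def)
qed

text \<open>The infinite rule implies the rules of all finite horizons, so every partial sum of the
  discounted series is already maximal and the comparison passes to the limit.\<close>

lemma rule_optimal_disc:
  assumes \<sigma>: "strategy M g \<sigma>" "obeys M g star_rule \<infinity> \<sigma>" and lam: "0 < lam" "lam \<le> 1"
  shows "optimal_disc M g lam \<sigma>"
proof -
  define b where "b = 1 - lam"
  have b: "0 \<le> b" "b < 1" using lam by (auto simp: b_def)
  have le: "payoff_disc g lam \<omega> z \<tau> \<le> payoff_disc g lam \<omega> z \<sigma>" if \<omega>: "\<omega> \<in> space M" for \<omega> z \<tau>
  proof -
    have "(\<Sum>m. b ^ m * stage_payoff g \<tau> \<omega> z m) \<le> (\<Sum>m. b ^ m * stage_payoff g \<sigma> \<omega> z m)"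
    proof (rule LIMSEQ_le)
      show "(\<lambda>n. \<Sum>m<n. b ^ m * stage_payoff g \<tau> \<omega> z m) \<longlonglongrightarrow> (\<Sum>m. b ^ m * stage_payoff g \<tau> \<omega> z m)"
        "(\<lambda>n. \<Sum>m<n. b ^ m * stage_payoff g \<sigma> \<omega> z m) \<longlonglongrightarrow> (\<Sum>m. b ^ m * stage_payoff g \<sigma> \<omega> z m)"
        by (intro summable_LIMSEQ summable_discounted \<omega> b)+
      show "\<exists>N. \<forall>n\<ge>N. (\<Sum>m<n. b ^ m * stage_payoff g \<tau> \<omega> z m) \<le> (\<Sum>m<n. b ^ m * stage_payoff g \<sigma> \<omega> z m)"
        using discounted_sum_le_dp_value[OF b(1), of \<tau> \<omega> z]
          rule_discounted_sum[OF obeys_infinity_imp[OF \<sigma>(2)] \<omega> b(1) less_imp_le[OF b(2)]]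
        by simp
    qed
    then show ?thesis using lam by (simp add: payoff_disc_def b_def mult_left_mono)
  qed
  have "value_disc M g lam \<omega> z = payoff_disc g lam \<omega> z \<sigma>" if "\<omega> \<in> space M" for \<omega> z
    unfolding value_disc_def using le[OF that] \<sigma>(1) by (intro cSup_eq_maximum) auto
  then show ?thesis using \<sigma>(1) by (auto simp: optimal_disc_def)
qed

end

section \<open>A strong law for orthogonal sequences\<close>

text \<open>Between \<open>r^2\<close> and \<open>(r + 1)^2\<close> the sequence moves by at most
  \<open>2 * r * C\<close>, which is negligible against \<open>r^2\<close>.\<close>

lemma tendsto_average_of_squares:
  fixes T :: "nat \<Rightarrow> real"
  assumes step: "\<And>n. \<bar>T (Suc n) - T n\<bar> \<le> C"
    and squares: "(\<lambda>n. T ((Suc n)\<^sup>2) / real ((Suc n)\<^sup>2)) \<longlonglongrightarrow> 0"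
  shows "(\<lambda>n. T n / real n) \<longlonglongrightarrow> 0"
proof -
  have C: "0 \<le> C" using step[of 0] by linarith
  have dist: "\<bar>T (m + k) - T m\<bar> \<le> real k * C" for m k
  proof (induction k)
    case (Suc k)
    then show ?case using step[of "m + k"] by (simp add: algebra_simps)
  qed simp
  have lim: "(\<lambda>r. \<bar>T (r\<^sup>2) / real (r\<^sup>2)\<bar> + 2 * C / real r) \<longlonglongrightarrow> 0"
  proof -
    have "(\<lambda>r. T (r\<^sup>2) / real (r\<^sup>2)) \<longlonglongrightarrow> 0"
      using squares by (subst (asm) filterlim_sequentially_Suc)
    moreover have "(\<lambda>r. 2 * C / real r) \<longlonglongrightarrow> 0"
      by (rule lim_const_over_n)
    ultimately show ?thesis
      by (intro tendsto_add_zero tendsto_rabs_zero)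
  qed
  have "filterlim floor_sqrt at_top at_top"
    unfolding filterlim_at_top
  proof
    fix Z show "\<forall>\<^sub>F n in sequentially. Z \<le> floor_sqrt n"
      using eventually_ge_at_top[of "Z\<^sup>2"] by eventually_elim (rule le_floor_sqrtI)
  qed
  from filterlim_compose[OF lim this]
  have lim': "(\<lambda>n. \<bar>T ((floor_sqrt n)\<^sup>2) / real ((floor_sqrt n)\<^sup>2)\<bar> + 2 * C / real (floor_sqrt n))
    \<longlonglongrightarrow> 0" .
  have "\<forall>\<^sub>F n in sequentially. norm (T n / real n)
      \<le> \<bar>T ((floor_sqrt n)\<^sup>2) / real ((floor_sqrt n)\<^sup>2)\<bar> + 2 * C / real (floor_sqrt n)"
    using eventually_ge_at_top[of 1]
  proof eventually_elim
    fix n :: nat assume n: "1 \<le> n"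
    define r where "r = floor_sqrt n"
    have r: "0 < r" "r\<^sup>2 \<le> n" using n by (auto simp: r_def)
    have "n < (Suc r)\<^sup>2" unfolding r_def by (rule Suc_floor_sqrt_power2_gt)
    then have k: "n - r\<^sup>2 \<le> 2 * r" by (simp add: power2_eq_square)
    have "\<bar>T n - T (r\<^sup>2)\<bar> \<le> real (n - r\<^sup>2) * C"
      using dist[of "r\<^sup>2" "n - r\<^sup>2"] r by simp
    also have "\<dots> \<le> real (2 * r) * C"
      using k C by (intro mult_right_mono) (auto simp only: of_nat_le_iff)
    finally have "\<bar>T n\<bar> \<le> \<bar>T (r\<^sup>2)\<bar> + 2 * real r * C" by simp
    then have "\<bar>T n\<bar> / real n \<le> (\<bar>T (r\<^sup>2)\<bar> + 2 * real r * C) / real n"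
      by (simp add: divide_right_mono)
    also have "\<dots> \<le> (\<bar>T (r\<^sup>2)\<bar> + 2 * real r * C) / real (r\<^sup>2)"
      using r C n by (intro divide_left_mono) (auto simp only: of_nat_le_iff intro!: add_nonneg_nonneg mult_pos_pos, auto)
    also have "\<dots> = \<bar>T (r\<^sup>2) / real (r\<^sup>2)\<bar> + 2 * C / real r"
      using r by (simp add: add_divide_distrib power2_eq_square)
    finally show "norm (T n / real n) \<le> \<bar>T (r\<^sup>2) / real (r\<^sup>2)\<bar> + 2 * C / real r"
      by simp
  qed
  from Lim_null_comparison[OF this lim'] show ?thesis .
qed

text \<open>Orthogonality bounds the second moment of the \<open>n\<close>-th partial sum by
  \<open>n * C^2\<close>. Along squares the averages then have summable second moments and converge;
  \<open>tendsto_average_of_squares\<close> fills the gaps.\<close>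

lemma (in prob_space) strong_law_orthogonal:
  fixes X :: "nat \<Rightarrow> 'a \<Rightarrow> real"
  assumes [measurable]: "\<And>n. random_variable borel (X n)"
    and bounded: "\<And>n \<omega>. \<omega> \<in> space M \<Longrightarrow> \<bar>X n \<omega>\<bar> \<le> C"
    and orthogonal: "\<And>n. expectation (\<lambda>\<omega>. (\<Sum>i<n. X i \<omega>) * X n \<omega>) = 0"
  shows "AE \<omega> in M. (\<lambda>n. (\<Sum>i<n. X i \<omega>) / real n) \<longlonglongrightarrow> 0"
proof -
  define T where "T n \<omega> = (\<Sum>i<n. X i \<omega>)" for n \<omega>
  have T_meas [measurable]: "random_variable borel (T n)" for n
    unfolding T_def by measurable
  have T_bound: "\<bar>T n \<omega>\<bar> \<le> real n * C" if "\<omega> \<in> space M" for n \<omega>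
    unfolding T_def using sum_bounded_above[of "{..<n}" "\<lambda>i. \<bar>X i \<omega>\<bar>" C] bounded[OF that]
    by (intro order_trans[OF sum_abs]) auto
  have int_prod: "integrable M (\<lambda>\<omega>. F \<omega> * G \<omega>)"
    if "random_variable borel F" "random_variable borel G"
      "\<And>\<omega>. \<omega> \<in> space M \<Longrightarrow> \<bar>F \<omega>\<bar> \<le> c" "\<And>\<omega>. \<omega> \<in> space M \<Longrightarrow> \<bar>G \<omega>\<bar> \<le> d" for F G :: "'a \<Rightarrow> real" and c d
  proof (rule integrable_const_bound[where B = "c * d"])
    have "\<bar>F \<omega>\<bar> * \<bar>G \<omega>\<bar> \<le> c * d" if "\<omega> \<in> space M" for \<omega>
    proof (rule mult_mono)
      show "0 \<le> c" using \<open>\<And>\<omega>. \<omega> \<in> space M \<Longrightarrow> \<bar>F \<omega>\<bar> \<le> c\<close>[OF that] by linarith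
    qed (use that \<open>\<And>\<omega>. \<omega> \<in> space M \<Longrightarrow> \<bar>F \<omega>\<bar> \<le> c\<close> \<open>\<And>\<omega>. \<omega> \<in> space M \<Longrightarrow> \<bar>G \<omega>\<bar> \<le> d\<close> in auto)
    then show "AE \<omega> in M. norm (F \<omega> * G \<omega>) \<le> c * d" by (intro AE_I2) (simp add: abs_mult)
  qed (use that in measurable)
  have int_T: "integrable M (\<lambda>\<omega>. T n \<omega> * T n \<omega>)" for n
    by (rule int_prod[OF T_meas T_meas T_bound T_bound])
  have second_moment: "expectation (\<lambda>\<omega>. T n \<omega> * T n \<omega>) \<le> real n * C\<^sup>2" for n
  proof (induction n)
    case (Suc n)
    have int_TX: "integrable M (\<lambda>\<omega>. T n \<omega> * X n \<omega>)"
      by (rule int_prod[OF T_meas _ T_bound bounded]) measurable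
    have int_XX: "integrable M (\<lambda>\<omega>. X n \<omega> * X n \<omega>)"
      by (rule int_prod[OF _ _ bounded bounded]) measurable
    have "X n \<omega> * X n \<omega> \<le> C\<^sup>2" if "\<omega> \<in> space M" for \<omega>
      using power_mono[OF bounded[OF that, of n], of 2] by (simp add: power2_eq_square)
    then have "expectation (\<lambda>\<omega>. X n \<omega> * X n \<omega>) \<le> expectation (\<lambda>_. C\<^sup>2)"
      by (intro integral_mono_AE int_XX) auto
    moreover have "expectation (\<lambda>\<omega>. T (Suc n) \<omega> * T (Suc n) \<omega>)
        = expectation (\<lambda>\<omega>. T n \<omega> * T n \<omega> + 2 * (T n \<omega> * X n \<omega>) + X n \<omega> * X n \<omega>)"
      by (rule Bochner_Integration.integral_cong) (auto simp: T_def algebra_simps)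
    moreover have "\<dots> = expectation (\<lambda>\<omega>. T n \<omega> * T n \<omega>) + expectation (\<lambda>\<omega>. X n \<omega> * X n \<omega>)"
      using int_T int_TX int_XX orthogonal[of n] by (simp add: T_def)
    ultimately show ?case using Suc by (simp add: algebra_simps prob_space)
  qed (simp add: T_def)

  define Y where "Y n \<omega> = (T ((Suc n)\<^sup>2) \<omega> / real ((Suc n)\<^sup>2))\<^sup>2" for n \<omega>
  have Y_meas [measurable]: "random_variable borel (Y n)" for n
    unfolding Y_def by measurable
  have Y_eq: "Y n \<omega> = T ((Suc n)\<^sup>2) \<omega> * T ((Suc n)\<^sup>2) \<omega> / (real ((Suc n)\<^sup>2))\<^sup>2" for n \<omega>
    by (simp add: Y_def power_divide power2_eq_square)
  have Y_int: "integrable M (Y n)" for n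
    unfolding Y_eq[abs_def] by (intro integrable_divide int_T)
  have Y_exp: "expectation (Y n) \<le> C\<^sup>2 * inverse ((real (Suc n))\<^sup>2)" for n
  proof -
    have "expectation (Y n) = expectation (\<lambda>\<omega>. T ((Suc n)\<^sup>2) \<omega> * T ((Suc n)\<^sup>2) \<omega>) / (real ((Suc n)\<^sup>2))\<^sup>2"
      unfolding Y_eq[abs_def] by simp
    also have "\<dots> \<le> real ((Suc n)\<^sup>2) * C\<^sup>2 / (real ((Suc n)\<^sup>2))\<^sup>2"
      by (intro divide_right_mono second_moment) simp
    also have "\<dots> = C\<^sup>2 * inverse ((real (Suc n))\<^sup>2)"
      unfolding of_nat_power by (simp add: power2_eq_square field_simps del: of_nat_Suc)
    finally show ?thesis .
  qed
  have "summable (\<lambda>n. C\<^sup>2 * inverse ((real (Suc n))\<^sup>2))"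
    using inverse_power_summable[of 2, where 'a = real]
    by (intro summable_mult) (subst summable_Suc_iff[of "\<lambda>n. inverse ((real n)\<^sup>2)"], simp)
  then have "summable (\<lambda>n. expectation (Y n))"
    by (rule summable_comparison_test'[of _ 0]) (use Y_exp in \<open>simp add: Y_def\<close>)
  then have sum_finite: "(\<Sum>n. ennreal (expectation (Y n))) \<noteq> \<infinity>"
    by (subst suminf_ennreal2) (auto simp: Y_def)
  \<comment> \<open>By monotone convergence the series of the \<open>Y n\<close> has finite
    expectation, so almost surely it converges and its terms tend to 0.\<close>
  have "(\<integral>\<^sup>+ \<omega>. (\<Sum>n. ennreal (Y n \<omega>)) \<partial>M) = (\<Sum>n. \<integral>\<^sup>+ \<omega>. ennreal (Y n \<omega>) \<partial>M)"
    by (rule nn_integral_suminf) measurable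
  also have "\<dots> = (\<Sum>n. ennreal (expectation (Y n)))"
    by (intro suminf_cong nn_integral_eq_integral Y_int) (simp add: Y_def)
  finally have "AE \<omega> in M. (\<Sum>n. ennreal (Y n \<omega>)) \<noteq> \<infinity>"
    using sum_finite by (intro nn_integral_PInf_AE) simp_all
  with AE_space show ?thesis
  proof eventually_elim
    fix \<omega> assume \<omega>: "\<omega> \<in> space M" "(\<Sum>n. ennreal (Y n \<omega>)) \<noteq> \<infinity>"
    then have "summable (\<lambda>n. Y n \<omega>)"
      by (intro summable_suminf_not_top) (simp_all add: Y_def)
    then have "(\<lambda>n. sqrt (Y n \<omega>)) \<longlonglongrightarrow> sqrt 0"
      by (intro tendsto_real_sqrt summable_LIMSEQ_zero)
    then have "(\<lambda>n. T ((Suc n)\<^sup>2) \<omega> / real ((Suc n)\<^sup>2)) \<longlonglongrightarrow> 0"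
      unfolding Y_def real_sqrt_abs real_sqrt_zero by (rule tendsto_rabs_zero_cancel)
    moreover have "\<bar>T (Suc n) \<omega> - T n \<omega>\<bar> \<le> C" for n
      using bounded[OF \<omega>(1)] by (simp add: T_def)
    ultimately have "(\<lambda>n. T n \<omega> / real n) \<longlonglongrightarrow> 0"
      by (intro tendsto_average_of_squares)
    then show "(\<lambda>n. (\<Sum>i<n. X i \<omega>) / real n) \<longlonglongrightarrow> 0"
      by (simp add: T_def)
  qed
qed

section \<open>The net payoff of covering a distance\<close>

text \<open>Let \<open>U n\<close> be the largest value of (payoff \<open>- v \<cdot>\<close> number of steps) over the paths from
  \<open>z\<close> to \<open>z + n\<close>. Its increments satisfy \<open>D' = max (a - v) (b - v - D)\<close>, where \<open>a\<close> and \<open>b\<close> are the payoffs of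
  the two edges entering the new endpoint; for \<open>0 \<le> v \<le> 1\<close> only the four values below occur.\<close>

datatype slope = Neg_v | One_minus_v | Zero | One

lemma UNIV_slope: "(UNIV :: slope set) = {Neg_v, One_minus_v, Zero, One}"
  using slope.exhaust by auto

instance slope :: finite
  by standard (simp add: UNIV_slope)

primrec slope_val :: "real \<Rightarrow> slope \<Rightarrow> real" where
  "slope_val v Neg_v = - v"
| "slope_val v One_minus_v = 1 - v"
| "slope_val v Zero = 0"
| "slope_val v One = 1"

text \<open>Slopes are labels, not numbers, so the chain is the same for all \<open>v\<close>
  between 0 and 1 and can be analysed before \<open>v\<close> is chosen.\<close>

fun slope_step :: "slope \<Rightarrow> bool \<Rightarrow> bool \<Rightarrow> slope" where
  "slope_step Neg_v a b = (if b then One else if a then One_minus_v else Zero)"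
| "slope_step One_minus_v a b = (if b then if a then One_minus_v else Zero
     else if a then One_minus_v else Neg_v)"
| "slope_step Zero a b = (if a \<or> b then One_minus_v else Neg_v)"
| "slope_step One a b = (if a then One_minus_v else Neg_v)"

lemma slope_val_step:
  assumes "0 \<le> v" "v \<le> 1"
  shows "slope_val v (slope_step s a b) = max (of_bool a - v) (of_bool b - v - slope_val v s)"
  using assms by (cases s) auto

text \<open>The virtual initial slope 1 is chosen because then the +2 edge coming from \<open>z - 1\<close>
  never beats the +1 edge from \<open>z\<close>.\<close>

primrec slope_at :: "(int \<Rightarrow> act \<Rightarrow> real) \<Rightarrow> int \<Rightarrow> nat \<Rightarrow> slope" where
  "slope_at h z 0 = One"
| "slope_at h z (Suc n) =
     slope_step (slope_at h z n) (h (z + int n) Plus1 = 1) (h (z + int n - 1) Plus2 = 1)"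

text \<open>The index \<open>Suc i\<close> leaves the virtual initial slope out of the sum.\<close>

definition potential :: "real \<Rightarrow> (int \<Rightarrow> act \<Rightarrow> real) \<Rightarrow> int \<Rightarrow> nat \<Rightarrow> real" where
  "potential v h z n = (\<Sum>i<n. slope_val v (slope_at h z (Suc i)))"

locale potential_field = payoff_field h 1 for h +
  fixes v :: real and z :: int
  assumes v_range: "0 \<le> v" "v \<le> 1"
begin

abbreviation U :: "nat \<Rightarrow> real" where
  "U \<equiv> potential v h z"

lemma of_bool_payoff: "of_bool (h y i = 1) = h y i"
  using payoff_range[of y i] by auto

lemma U_Suc_0: "U (Suc 0) = U 0 + (h z Plus1 - v)"
  using slope_val_step[OF v_range] payoff_le_1[of "z - 1" Plus2] payoff_ge_0[of z Plus1]
  by (simp add: potential_def of_bool_payoff del: slope_step.simps)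

text \<open>The recursion for the best path by its last edge: subtracting the last slope from
  \<open>U (Suc n)\<close> gives \<open>U n\<close>.\<close>

lemma U_Suc_Suc:
  "U (Suc (Suc n)) = max (U (Suc n) + (h (z + int (Suc n)) Plus1 - v)) (U n + (h (z + int n) Plus2 - v))"
  using slope_val_step[OF v_range]
  by (simp add: potential_def of_bool_payoff max_add_distrib_right algebra_simps del: slope_step.simps)

section \<open>Comparison of net payoffs with the value of \<open>N\<close> stages\<close>

lemma U_step_ge: "U n + (h (z + int n) i - v) \<le> U (n + nat (jump i))"
proof (cases i)
  case Plus1
  then show ?thesis using U_Suc_0 U_Suc_Suc by (cases n) (simp_all)
next
  case Plus2
  then show ?thesis using U_Suc_Suc[of n] by (simp add: numeral_2_eq_2)
qed

text \<open>Append an optimal play to a best path to \<open>z + n\<close>; \<open>L\<close> is the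
  distance covered in the end.\<close>

lemma V_le_potential:
  "\<exists>L\<le>n + 2 * N. V N (z + int n) + U n \<le> v * real N + U L"
proof (induction N arbitrary: n)
  case (Suc N)
  have "\<exists>i. V (Suc N) y = h y i + V N (y + jump i)" for y
    by (metis dp_value.simps(2) jump.simps max_def mult_1)
  then obtain i where i: "V (Suc N) (z + int n) = h (z + int n) i + V N (z + int n + jump i)"
    by blast
  obtain L where L: "L \<le> n + nat (jump i) + 2 * N"
    "V N (z + int (n + nat (jump i))) + U (n + nat (jump i)) \<le> v * real N + U L"
    using Suc by blast
  have jump: "nat (jump i) \<le> 2" "z + int (n + nat (jump i)) = z + int n + jump i"
    by (cases i; simp)+
  have "V (Suc N) (z + int n) + U n \<le> v * real (Suc N) + U L"
    using i L(2) U_step_ge[of n i] unfolding jump(2) by (simp add: algebra_simps)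
  then show ?case using L(1) jump(1) by (intro exI[of _ L]) auto
qed auto

text \<open>\<open>tight m x\<close> is the consequence, for the value function, of a path with \<open>m\<close> steps from
  \<open>z\<close> to \<open>z + x\<close> that attains \<open>U x\<close>.\<close>

definition tight :: "nat \<Rightarrow> nat \<Rightarrow> bool" where
  "tight m x \<longleftrightarrow> (\<forall>k. v * real m + U x + V k (z + int x) \<le> V (m + k) z)"

lemma tight_step:
  assumes "tight m x" "U (x + nat (jump i)) = U x + (h (z + int x) i - v)"
  shows "tight (Suc m) (x + nat (jump i))"
  unfolding tight_def
proof
  fix k
  have jump: "z + int (x + nat (jump i)) = z + int x + jump i"
    by (cases i; simp)
  have "v * real m + U x + V (Suc k) (z + int x) \<le> V (m + Suc k) z"
    using assms(1) unfolding tight_def by blast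
  then show "v * real (Suc m) + U (x + nat (jump i)) + V k (z + int (x + nat (jump i))) \<le> V (Suc m + k) z"
    using dp_value_ge[of h "z + int x" i 1 k] assms(2) unfolding jump by (simp add: algebra_simps)
qed

text \<open>Follow a best path back along its last edges. All its prefixes are tight too, so every
  smaller number of steps occurs; no step is longer than 2.\<close>

lemma tight_path: "\<exists>m. x \<le> 2 * m \<and> tight m x \<and> (\<forall>j\<le>m. \<exists>y\<le>x. tight j y)"
proof (induction x rule: less_induct)
  case (less x)
  have extend: "\<exists>m. x \<le> 2 * m \<and> tight m x \<and> (\<forall>j\<le>m. \<exists>y\<le>x. tight j y)"
    if x: "x = x' + nat (jump i)" "U x = U x' + (h (z + int x') i - v)" for x' i
  proof -
    have "x' < x" "nat (jump i) \<le> 2" using x(1) by (cases i; simp)+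
    then obtain m where m: "x' \<le> 2 * m" "tight m x'" "\<forall>j\<le>m. \<exists>y\<le>x'. tight j y"
      using less by blast
    have "tight (Suc m) x" using tight_step[OF m(2)] x by simp
    moreover have "\<exists>y\<le>x. tight j y" if "j \<le> Suc m" for j
    proof (cases "j = Suc m")
      case True
      then show ?thesis using \<open>tight (Suc m) x\<close> by blast
    next
      case False
      then show ?thesis using m(3) \<open>x' < x\<close> that by (meson le_SucE le_trans less_imp_le)
    qed
    ultimately show ?thesis
      using m(1) x(1) \<open>nat (jump i) \<le> 2\<close> by (intro exI[of _ "Suc m"]) auto
  qed
  consider "x = 0" | "x = Suc 0" | n where "x = Suc (Suc n)"
    by (metis not0_implies_Suc)
  then show ?case
  proof cases
    case 1
    then show ?thesis by (intro exI[of _ 0]) (auto simp: tight_def potential_def)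
  next
    case 2
    then show ?thesis using extend[of 0 Plus1] U_Suc_0 by simp
  next
    case (3 n)
    show ?thesis
    proof (cases "U x = U (Suc n) + (h (z + int (Suc n)) Plus1 - v)")
      case True
      then show ?thesis using extend[of "Suc n" Plus1] 3 by simp
    next
      case False
      then have "U x = U n + (h (z + int n) Plus2 - v)"
        using U_Suc_Suc[of n] unfolding 3 by (simp add: max_def split: if_splits)
      then show ?thesis using extend[of n Plus2] 3 by simp
    qed
  qed
qed

text \<open>A best path over the distance \<open>2 * N\<close> has at least \<open>N\<close> steps;
  cut after exactly \<open>N\<close>, it is a play of \<open>N\<close> stages.\<close>

lemma V_ge_potential: "\<exists>L\<le>2 * N. v * real N + U L \<le> V N z"
proof -
  obtain m where m: "2 * N \<le> 2 * m" "\<forall>j\<le>m. \<exists>y\<le>2 * N. tight j y"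
    using tight_path[of "2 * N"] by blast
  then obtain L where L: "L \<le> 2 * N" "tight N L" by auto
  from L(2) have "v * real N + U L + V 0 (z + int L) \<le> V (N + 0) z"
    unfolding tight_def by blast
  then show ?thesis using L(1) by auto
qed

lemma V_average_tendsto:
  assumes "(\<lambda>n. U n / real n) \<longlonglongrightarrow> 0"
  shows "(\<lambda>N. V N z / real N) \<longlonglongrightarrow> v"
proof (rule LIMSEQ_I)
  fix \<epsilon> :: real assume \<epsilon>: "0 < \<epsilon>"
  \<comment> \<open>Distances up to \<open>2 * N\<close> occur, so \<open>\<epsilon> / 4\<close> per
    unit of distance makes \<open>\<epsilon> / 2\<close> per stage; the other half is for the
    constant \<open>C\<close>.\<close>
  then obtain n0 where n0: "\<And>n. n \<ge> n0 \<Longrightarrow> norm (U n / real n - 0) < \<epsilon> / 4"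
    using LIMSEQ_D[OF assms, of "\<epsilon> / 4"] by auto
  define C where "C = (\<Sum>n<n0. \<bar>U n\<bar>)"
  have C: "\<bar>U n\<bar> \<le> C + \<epsilon> / 4 * real n" for n
  proof (cases "n < n0")
    case True
    then have "\<bar>U n\<bar> \<le> C" unfolding C_def by (intro member_le_sum) auto
    moreover have "0 \<le> \<epsilon> / 4 * real n" using \<epsilon> by simp
    ultimately show ?thesis by linarith
  next
    case False
    have "0 \<le> C" by (auto simp: C_def intro: sum_nonneg)
    moreover have "\<bar>U n\<bar> \<le> \<epsilon> / 4 * real n"
      using n0[of n] False by (cases "n = 0") (auto simp: potential_def field_simps)
    ultimately show ?thesis by linarith
  qed
  have bound: "\<bar>V N z - v * real N\<bar> \<le> C + \<epsilon> / 2 * real N" for N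
  proof -
    have C': "\<bar>U L\<bar> \<le> C + \<epsilon> / 2 * real N" if "L \<le> 2 * N" for L
    proof -
      have "\<epsilon> / 4 * real L \<le> \<epsilon> / 4 * real (2 * N)"
        using \<epsilon> that by (intro mult_left_mono) simp_all
      then show ?thesis using C[of L] by simp
    qed
    obtain L L' where "L \<le> 2 * N" "V N z + U 0 \<le> v * real N + U L"
      "L' \<le> 2 * N" "v * real N + U L' \<le> V N z"
      using V_le_potential[of 0 N] V_ge_potential[of N] by auto
    moreover have "U 0 = 0" by (simp add: potential_def)
    ultimately show ?thesis using C'[of L] C'[of L'] by linarith
  qed
  obtain N0 where N0: "2 * C / \<epsilon> < real N0" using reals_Archimedean2 by blast
  show "\<exists>no. \<forall>n\<ge>no. norm (V n z / real n - v) < \<epsilon>"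
  proof (intro exI allI impI)
    fix N assume "Suc N0 \<le> N"
    then have N: "0 < real N" "2 * C / \<epsilon> < real N" using N0 by auto
    have "V N z / real N - v = (V N z - v * real N) / real N"
      using N(1) by (simp add: diff_divide_distrib)
    then have "norm (V N z / real N - v) = \<bar>V N z - v * real N\<bar> / real N"
      by simp
    also have "\<dots> \<le> (C + \<epsilon> / 2 * real N) / real N"
      using bound[of N] by (rule divide_right_mono) simp
    also have "\<dots> < \<epsilon>"
      using N \<epsilon> by (simp add: field_simps)
    finally show "norm (V N z / real N - v) < \<epsilon>" .
  qed
qed

end

section \<open>The limit value\<close>

context
  fixes p :: real
begin

text \<open>The coefficient of \<open>bias_unit\<close> in the Poisson equation at
  \<open>One_minus_v\<close>, once the other three equations have been used to eliminate
  \<open>mean_payoff\<close> and the remaining biases.\<close>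

definition bias_denom :: real where
  "bias_denom = 1 + p * (1 - p) * (2 - p) * (1 - 2 * p)"

definition bias_unit :: real where
  "bias_unit = (1 - p) / bias_denom"

text \<open>\<open>bias\<close> solves the Poisson equation of the slope chain, normalised by \<open>bias Neg_v = 0\<close>;
  \<open>mean_payoff\<close> is the only \<open>v\<close> for which that equation is solvable, i.e. for which the slopes
  have stationary mean 0.\<close>

definition mean_payoff :: real where
  "mean_payoff = p + bias_unit * ((1 - p)\<^sup>2 * (p * (2 - p)) + p)"

primrec bias :: "slope \<Rightarrow> real" where
  "bias Neg_v = 0"
| "bias One_minus_v = bias_unit"
| "bias Zero = p * (2 - p) * bias_unit"
| "bias One = 1 + p * bias_unit"

definition bernoulli_mean :: "(bool \<Rightarrow> bool \<Rightarrow> real) \<Rightarrow> real" where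
  "bernoulli_mean f = p * p * f True True + p * (1 - p) * f True False
     + (1 - p) * p * f False True + (1 - p) * (1 - p) * f False False"

definition next_bias :: "slope \<Rightarrow> real" where
  "next_bias s = bernoulli_mean (\<lambda>a b. bias (slope_step s a b))"

text \<open>A martingale difference: the new bias minus its conditional mean given the past.\<close>

definition increment :: "(int \<Rightarrow> act \<Rightarrow> real) \<Rightarrow> int \<Rightarrow> nat \<Rightarrow> real" where
  "increment h z n = bias (slope_at h z (Suc n)) - next_bias (slope_at h z n)"

context
  assumes p: "0 \<le> p" "p \<le> 1"
begin

text \<open>The factor \<open>(2 - p) * (1 - 2 * p) = 2 * (1 - p)^2 - p\<close> is at least -1, and
  \<open>p * (1 - p) < 1\<close>.\<close>

lemma bias_denom_pos: "0 < bias_denom"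
proof -
  have "0 \<le> p * (1 - p)"
    using p by simp
  moreover have "- 1 \<le> 2 * (1 - p)\<^sup>2 - p"
    using p zero_le_power2[of "1 - p"] by linarith
  ultimately have "p * (1 - p) * (- 1) \<le> p * (1 - p) * (2 * (1 - p)\<^sup>2 - p)"
    by (rule mult_left_mono[rotated])
  moreover have "bias_denom = 1 + p * (1 - p) * (2 * (1 - p)\<^sup>2 - p)"
    by (simp add: bias_denom_def power2_eq_square algebra_simps)
  moreover have "p * (1 - p) < 1"
    using p zero_le_power2[of "p - 1 / 2"] by (simp add: power2_eq_square algebra_simps)
  ultimately show ?thesis by linarith
qed

lemma bias_unit_eq: "bias_unit * bias_denom = 1 - p"
  using bias_denom_pos by (simp add: bias_unit_def)

lemma poisson_equation: "slope_val mean_payoff s = bias s - next_bias s"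
proof -
  have eq: "1 - p = bias_unit * (1 + p * (1 - p) * (2 - p) * (1 - 2 * p))"
    using bias_unit_eq unfolding bias_denom_def by simp
  show ?thesis
  proof (cases s)
    \<comment> \<open>For the other slopes the equation is an identity; here it determines
      \<open>bias_unit\<close>.\<close>
    case One_minus_v
    then show ?thesis using eq
      by (simp add: next_bias_def bernoulli_mean_def mean_payoff_def power2_eq_square algebra_simps)
  qed (simp_all add: next_bias_def bernoulli_mean_def mean_payoff_def power2_eq_square algebra_simps)
qed

text \<open>This makes \<open>mean_payoff\<close> admissible for the slope chain. The upper bound
  comes from factoring \<open>1 - mean_payoff\<close> as
  \<open>bias_unit * (1 - p) * (1 - p^2 * (2 - p))\<close>.\<close>

lemma mean_payoff_range: "0 \<le> mean_payoff" "mean_payoff \<le> 1"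
proof -
  have unit: "0 \<le> bias_unit"
    using p bias_denom_pos by (simp add: bias_unit_def)
  then show "0 \<le> mean_payoff"
    using p by (simp add: mean_payoff_def)
  have "p * (p * (2 - p)) \<le> 1 * 1"
  proof (rule mult_mono)
    have "p * (2 - p) = 1 - (1 - p)\<^sup>2" by (simp add: power2_eq_square algebra_simps)
    then show "p * (2 - p) \<le> 1" by simp
  qed (use p in auto)
  then have "0 \<le> bias_unit * ((1 - p) * (1 - p * (p * (2 - p))))"
    using unit p by (intro mult_nonneg_nonneg) auto
  also have "(1 - p) * (1 - p * (p * (2 - p))) = bias_denom - ((1 - p)\<^sup>2 * (p * (2 - p)) + p)"
    by (simp add: bias_denom_def power2_eq_square algebra_simps)
  also have "bias_unit * \<dots> = 1 - mean_payoff"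
    by (simp only: right_diff_distrib[of bias_unit bias_denom] bias_unit_eq mean_payoff_def)
  finally show "mean_payoff \<le> 1" by simp
qed

text \<open>Numerator and denominator share the factor \<open>- p\<close>, and
  \<open>bias_denom\<close> is what remains below.\<close>

lemma mean_payoff_eq:
  "mean_payoff = (if p = 0 then 0
     else (p^6 - 2*p^5 - 2*p^4 + 6*p^3 - 4*p^2) / (2*p^5 - 7*p^4 + 7*p^3 - 2*p^2 - p))"
proof (cases "p = 0")
  case False
  have denom: "2*p^5 - 7*p^4 + 7*p^3 - 2*p^2 - p = - p * bias_denom"
    by (simp add: bias_denom_def power_numeral_reduce algebra_simps)
  have "mean_payoff * bias_denom
      = p * bias_denom + (bias_unit * bias_denom) * ((1 - p)\<^sup>2 * (p * (2 - p)) + p)"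
    by (simp add: mean_payoff_def algebra_simps)
  also have "\<dots> = 4 * p - 6 * p^2 + 2 * p^3 + 2 * p^4 - p^5"
    unfolding bias_unit_eq unfolding bias_denom_def by (simp add: power_numeral_reduce algebra_simps)
  finally have "mean_payoff * (- p * bias_denom) = - p * (4 * p - 6 * p^2 + 2 * p^3 + 2 * p^4 - p^5)"
    by (simp add: mult.left_commute)
  also have "\<dots> = p^6 - 2*p^5 - 2*p^4 + 6*p^3 - 4*p^2"
    by (simp add: power_numeral_reduce algebra_simps)
  finally have "mean_payoff = (p^6 - 2*p^5 - 2*p^4 + 6*p^3 - 4*p^2) / (- p * bias_denom)"
    using False bias_denom_pos by (intro eq_divide_imp) simp_all
  then show ?thesis
    unfolding denom using False by (simp only: if_False)
next
  case True
  then show ?thesis unfolding mean_payoff_def by simp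
qed

text \<open>By the Poisson equation each slope is an increment plus a difference of consecutive
  values of \<open>next_bias\<close>, which telescopes.\<close>

lemma potential_eq_martingale:
  "potential mean_payoff h z n
    = (\<Sum>i<n. increment h z i) + next_bias (slope_at h z 0) - next_bias (slope_at h z n)"
  by (induction n) (simp_all add: potential_def increment_def poisson_equation del: slope_at.simps)

end

end

text \<open>\<open>N\<close> and \<open>H\<close> are general because both \<open>M\<close> and the
  product space of past payoffs are needed.\<close>

lemma measurable_slope_at:
  assumes "\<And>i. i < m \<Longrightarrow> (\<lambda>w. H w (z + int i) Plus1) \<in> borel_measurable N"
    and "\<And>i. i < m \<Longrightarrow> (\<lambda>w. H w (z + int i - 1) Plus2) \<in> borel_measurable N"
  shows "(\<lambda>w. slope_at (H w) z m) \<in> N \<rightarrow>\<^sub>M count_space UNIV"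
  using assms
proof (induction m)
  case (Suc m)
  have payoff1: "Measurable.pred N (\<lambda>w. H w (z + int m) Plus1 = 1)"
    and payoff2: "Measurable.pred N (\<lambda>w. H w (z + int m - 1) Plus2 = 1)"
    using Suc.prems[of m] by simp_all
  have "(\<lambda>w. slope_step s a (H w (z + int m - 1) Plus2 = 1)) \<in> N \<rightarrow>\<^sub>M count_space UNIV" for s a
    by (rule measurable_compose[OF payoff2]) simp
  then have "(\<lambda>w. slope_step s (H w (z + int m) Plus1 = 1) (H w (z + int m - 1) Plus2 = 1))
      \<in> N \<rightarrow>\<^sub>M count_space UNIV" for s
    by (rule measurable_compose_countable) (rule payoff1)
  moreover have "(\<lambda>w. slope_at (H w) z m) \<in> N \<rightarrow>\<^sub>M count_space UNIV"
    using Suc.prems by (intro Suc.IH) simp_all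
  ultimately show ?case
    unfolding slope_at.simps by (rule measurable_compose_countable)
qed simp

lemma slope_at_cong:
  assumes "\<And>i. i < m \<Longrightarrow> h (z + int i) Plus1 = h' (z + int i) Plus1"
    and "\<And>i. i < m \<Longrightarrow> h (z + int i - 1) Plus2 = h' (z + int i - 1) Plus2"
  shows "slope_at h z m = slope_at h' z m"
  using assms by (induction m) simp_all

section \<open>Almost sure convergence of the averages\<close>

context pmdp
begin

lemma random_variable_payoff [measurable]: "random_variable borel (\<lambda>\<omega>. g \<omega> z i)"
  using payoff_indep unfolding indep_vars_def by (auto dest: bspec[of _ _ "(z, i)"])

lemma payoff_bound: "\<omega> \<in> space M \<Longrightarrow> \<bar>g \<omega> z i\<bar> \<le> 1"
  using payoff_01[of \<omega> z i] by auto

lemma integrable_payoff: "integrable M (\<lambda>\<omega>. g \<omega> z i)"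
  by (rule integrable_const_bound[where B = 1]) (auto simp: payoff_bound)

lemma expectation_payoff: "expectation (\<lambda>\<omega>. g \<omega> z i) = p"
proof -
  have "expectation (\<lambda>\<omega>. g \<omega> z i) = integral\<^sup>L (distr M borel (\<lambda>\<omega>. g \<omega> z i)) (\<lambda>x. x)"
    by (subst integral_distr) simp_all
  also have "\<dots> = integral\<^sup>L (measure_pmf (bernoulli_pmf p)) of_bool"
    unfolding payoff_bernoulli by (subst integral_distr) simp_all
  also have "\<dots> = p"
    using p_range by simp
  finally show ?thesis .
qed

lemma expectation_payoff_pair:
  assumes "(z, i) \<noteq> (y, j)"
  shows "expectation (\<lambda>\<omega>. g \<omega> z i * g \<omega> y j) = p * p"
    and "integrable M (\<lambda>\<omega>. g \<omega> z i * g \<omega> y j)"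
proof -
  have "indep_vars (\<lambda>_. borel) (\<lambda>(z, i) \<omega>. g \<omega> z i) {(z, i), (y, j)}"
    by (rule indep_vars_subset[OF payoff_indep]) simp
  from indep_vars_lebesgue_integral[OF _ this] indep_vars_integrable[OF _ this] assms
  show "expectation (\<lambda>\<omega>. g \<omega> z i * g \<omega> y j) = p * p"
    "integrable M (\<lambda>\<omega>. g \<omega> z i * g \<omega> y j)"
    by (auto simp: integrable_payoff expectation_payoff)
qed

text \<open>A function of two bits is a polynomial of degree at most 1 in each, so the means and the
  mean of the product determine its expectation.\<close>

lemma expectation_bernoulli_pair:
  assumes "(z, i) \<noteq> (y, j)"
  shows "expectation (\<lambda>\<omega>. f (g \<omega> z i = 1) (g \<omega> y j = 1)) = bernoulli_mean p f"
proof -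
  have "expectation (\<lambda>\<omega>. f (g \<omega> z i = 1) (g \<omega> y j = 1))
      = expectation (\<lambda>\<omega>. f False False + (f True False - f False False) * g \<omega> z i
          + (f False True - f False False) * g \<omega> y j
          + (f True True - f True False - f False True + f False False) * (g \<omega> z i * g \<omega> y j))"
  proof (rule Bochner_Integration.integral_cong)
    fix \<omega> assume "\<omega> \<in> space M"
    then show "f (g \<omega> z i = 1) (g \<omega> y j = 1) = f False False + (f True False - f False False) * g \<omega> z i
          + (f False True - f False False) * g \<omega> y j
          + (f True True - f True False - f False True + f False False) * (g \<omega> z i * g \<omega> y j)"
      using payoff_01[of \<omega> z i] payoff_01[of \<omega> y j] by auto
  qed simp
  also have "\<dots> = bernoulli_mean p f"
    using expectation_payoff_pair[OF assms]
    by (simp add: integrable_payoff expectation_payoff prob_space bernoulli_mean_def algebra_simps)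
  finally show ?thesis .
qed

lemma bias_le: "\<bar>bias p s\<bar> \<le> (\<Sum>s\<in>UNIV. \<bar>bias p s\<bar>)"
  by (rule member_le_sum) simp_all

lemma next_bias_le: "\<bar>next_bias p s\<bar> \<le> (\<Sum>s\<in>UNIV. \<bar>next_bias p s\<bar>)"
  by (rule member_le_sum) simp_all

lemma increment_bound: "\<exists>C. \<forall>h z n. \<bar>increment p h z n\<bar> \<le> C"
proof -
  have "\<bar>bias p s - next_bias p t\<bar> \<le> (\<Sum>s\<in>UNIV. \<bar>bias p s\<bar>) + (\<Sum>s\<in>UNIV. \<bar>next_bias p s\<bar>)" for s t
    using bias_le[of s] next_bias_le[of t] by linarith
  then show ?thesis unfolding increment_def by blast
qed

text \<open>Given the current slope \<open>s\<close>, the new increment depends only on two fresh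
  edges and has mean 0, independently of the past.\<close>

lemma increment_orthogonal:
  "expectation (\<lambda>\<omega>. (\<Sum>i<n. increment p (g \<omega>) z i) * increment p (g \<omega>) z n) = 0"
proof -
  \<comment> \<open>The edges that determine the slopes up to index \<open>n\<close>, as against the
    two edges entering \<open>z + n + 1\<close>.\<close>
  define past where "past = {(z + int i, Plus1) | i. i < n} \<union> {(z + int i - 1, Plus2) | i. i < n}"
  define present where "present = {(z + int n, Plus1), (z + int n - 1, Plus2)}"
  define \<Phi> where "\<Phi> s h = (\<Sum>i<n. increment p h z i) * of_bool (slope_at h z n = s)" for s h
  define \<Psi> where "\<Psi> s h = bias p (slope_step s (h (z + int n) Plus1 = 1) (h (z + int n - 1) Plus2 = 1))
      - next_bias p s" for s and h :: "int \<Rightarrow> act \<Rightarrow> real"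
  obtain C where C: "\<And>h z n. \<bar>increment p h z n\<bar> \<le> C"
    using increment_bound by blast
  have slope_meas: "(\<lambda>\<omega>. slope_at (g \<omega>) z m) \<in> M \<rightarrow>\<^sub>M count_space UNIV" for m
    by (rule measurable_slope_at) simp_all
  have \<Psi>_mean: "expectation (\<lambda>\<omega>. \<Psi> s (g \<omega>)) = 0" for s
  proof -
    have "expectation (\<lambda>\<omega>. \<Psi> s (g \<omega>)) = bernoulli_mean p (\<lambda>a b. bias p (slope_step s a b) - next_bias p s)"
      unfolding \<Psi>_def by (rule expectation_bernoulli_pair) simp
    also have "\<dots> = 0"
      by (simp add: bernoulli_mean_def next_bias_def algebra_simps)
    finally show ?thesis .
  qed
  have \<Phi>_meas: "random_variable borel (\<lambda>\<omega>. \<Phi> s (g \<omega>))" for s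
    unfolding \<Phi>_def increment_def using slope_meas by measurable
  have \<Psi>_meas: "random_variable borel (\<lambda>\<omega>. \<Psi> s (g \<omega>))" for s
    unfolding \<Psi>_def by measurable
  have "\<bar>\<Phi> s h\<bar> \<le> real n * C" for s h
  proof -
    have "\<bar>\<Phi> s h\<bar> \<le> \<bar>\<Sum>i<n. increment p h z i\<bar>" by (simp add: \<Phi>_def)
    also have "\<dots> \<le> (\<Sum>i<n. \<bar>increment p h z i\<bar>)" by (rule sum_abs)
    also have "\<dots> \<le> real n * C" using sum_bounded_above[of "{..<n}" "\<lambda>i. \<bar>increment p h z i\<bar>" C] C by simp
    finally show ?thesis .
  qed
  then have \<Phi>_int: "integrable M (\<lambda>\<omega>. \<Phi> s (g \<omega>))" for s
    by (intro integrable_const_bound[where B = "real n * C"] \<Phi>_meas) simp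
  have "\<bar>\<Psi> s h\<bar> \<le> (\<Sum>s\<in>UNIV. \<bar>bias p s\<bar>) + \<bar>next_bias p s\<bar>" for s h
    unfolding \<Psi>_def
    using bias_le[of "slope_step s (h (z + int n) Plus1 = 1) (h (z + int n - 1) Plus2 = 1)"] by linarith
  then have \<Psi>_int: "integrable M (\<lambda>\<omega>. \<Psi> s (g \<omega>))" for s
    by (intro integrable_const_bound[OF _ \<Psi>_meas]) (auto intro!: AE_I2)
  have indep: "indep_var borel (\<lambda>\<omega>. \<Phi> s (g \<omega>)) borel (\<lambda>\<omega>. \<Psi> s (g \<omega>))" for s
  proof -
    \<comment> \<open>Payoffs over disjoint index sets are independent; \<open>\<Phi> s\<close> and
      \<open>\<Psi> s\<close> factor through these restrictions.\<close>
    have rv: "indep_var (PiM past (\<lambda>_. borel)) (\<lambda>\<omega>. restrict (\<lambda>k. (\<lambda>(z, i) \<omega>. g \<omega> z i) k \<omega>) past)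
        (PiM present (\<lambda>_. borel)) (\<lambda>\<omega>. restrict (\<lambda>k. (\<lambda>(z, i) \<omega>. g \<omega> z i) k \<omega>) present)"
      by (rule indep_var_restrict[OF payoff_indep]) (auto simp: past_def present_def)
    have component: "(\<lambda>w. curry w y i) \<in> borel_measurable (PiM K (\<lambda>_. borel))" if "(y, i) \<in> K"
      for K :: "(int \<times> act) set" and y i
      unfolding curry_def using that by (rule measurable_component_singleton)
    have slope_past: "(\<lambda>w. slope_at (curry w) z m) \<in> PiM past (\<lambda>_. borel) \<rightarrow>\<^sub>M count_space UNIV"
      if "m \<le> n" for m
      using that by (intro measurable_slope_at component) (auto simp: past_def)
    have "(\<lambda>w. \<Phi> s (curry w)) \<in> borel_measurable (PiM past (\<lambda>_. borel))"
      unfolding \<Phi>_def increment_def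
      by (intro borel_measurable_times borel_measurable_sum borel_measurable_diff
          measurable_compose[OF slope_past]) auto
    moreover have "(\<lambda>w. \<Psi> s (curry w)) \<in> borel_measurable (PiM present (\<lambda>_. borel))"
    proof -
      have [measurable]: "(\<lambda>w. curry w (z + int n) Plus1) \<in> borel_measurable (PiM present (\<lambda>_. borel))"
        "(\<lambda>w. curry w (z + int n - 1) Plus2) \<in> borel_measurable (PiM present (\<lambda>_. borel))"
        by (intro component; simp add: present_def)+
      show ?thesis unfolding \<Psi>_def by measurable
    qed
    ultimately have "indep_var borel ((\<lambda>w. \<Phi> s (curry w)) \<circ> (\<lambda>\<omega>. restrict (\<lambda>k. (\<lambda>(z, i) \<omega>. g \<omega> z i) k \<omega>) past))
        borel ((\<lambda>w. \<Psi> s (curry w)) \<circ> (\<lambda>\<omega>. restrict (\<lambda>k. (\<lambda>(z, i) \<omega>. g \<omega> z i) k \<omega>) present))"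
      by (rule indep_var_compose[OF rv])
    moreover have "slope_at (curry (restrict (\<lambda>k. (\<lambda>(z, i) \<omega>. g \<omega> z i) k \<omega>) past)) z m = slope_at (g \<omega>) z m"
      if "m \<le> n" for m \<omega>
      using that by (intro slope_at_cong) (auto simp: past_def)
    then have "(\<lambda>w. \<Phi> s (curry w)) \<circ> (\<lambda>\<omega>. restrict (\<lambda>k. (\<lambda>(z, i) \<omega>. g \<omega> z i) k \<omega>) past) = (\<lambda>\<omega>. \<Phi> s (g \<omega>))"
      by (auto simp: fun_eq_iff \<Phi>_def increment_def simp del: slope_at.simps intro!: sum.cong)
    moreover have "(\<lambda>w. \<Psi> s (curry w)) \<circ> (\<lambda>\<omega>. restrict (\<lambda>k. (\<lambda>(z, i) \<omega>. g \<omega> z i) k \<omega>) present) = (\<lambda>\<omega>. \<Psi> s (g \<omega>))"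
      by (simp add: fun_eq_iff \<Psi>_def present_def)
    ultimately show ?thesis by simp
  qed
  \<comment> \<open>Only the summand for the actual slope is nonzero.\<close>
  have "(\<Sum>i<n. increment p h z i) * increment p h z n = (\<Sum>s\<in>UNIV. \<Phi> s h * \<Psi> s h)" for h
    by (cases "slope_at h z n") (simp_all add: UNIV_slope \<Phi>_def \<Psi>_def increment_def)
  then have "expectation (\<lambda>\<omega>. (\<Sum>i<n. increment p (g \<omega>) z i) * increment p (g \<omega>) z n)
      = expectation (\<lambda>\<omega>. \<Sum>s\<in>UNIV. \<Phi> s (g \<omega>) * \<Psi> s (g \<omega>))"
    by simp
  also have "\<dots> = (\<Sum>s\<in>UNIV. expectation (\<lambda>\<omega>. \<Phi> s (g \<omega>) * \<Psi> s (g \<omega>)))"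
    by (intro Bochner_Integration.integral_sum indep_var_integrable indep \<Phi>_int \<Psi>_int)
  also have "\<dots> = 0"
    by (simp add: indep_var_lebesgue_integral[OF indep \<Phi>_int \<Psi>_int] \<Psi>_mean)
  finally show ?thesis .
qed

lemma potential_average: "AE \<omega> in M. (\<lambda>n. potential (mean_payoff p) (g \<omega>) z n / real n) \<longlonglongrightarrow> 0"
proof -
  obtain C where C: "\<And>h z n. \<bar>increment p h z n\<bar> \<le> C"
    using increment_bound by blast
  have slope_meas: "(\<lambda>\<omega>. slope_at (g \<omega>) z m) \<in> M \<rightarrow>\<^sub>M count_space UNIV" for m
    by (rule measurable_slope_at) simp_all
  have "random_variable borel (\<lambda>\<omega>. increment p (g \<omega>) z n)" for n
    unfolding increment_def by (intro borel_measurable_diff measurable_compose[OF slope_meas]) simp_all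
  then have "AE \<omega> in M. (\<lambda>n. (\<Sum>i<n. increment p (g \<omega>) z i) / real n) \<longlonglongrightarrow> 0"
    by (rule strong_law_orthogonal[OF _ C increment_orthogonal])
  then show ?thesis
  proof eventually_elim
    fix \<omega> assume lim: "(\<lambda>n. (\<Sum>i<n. increment p (g \<omega>) z i) / real n) \<longlonglongrightarrow> 0"
    \<comment> \<open>The correction to the martingale is bounded, so it vanishes after division by
      \<open>n\<close>.\<close>
    define K where "K = \<bar>next_bias p (slope_at (g \<omega>) z 0)\<bar> + (\<Sum>s\<in>UNIV. \<bar>next_bias p s\<bar>)"
    have "\<bar>next_bias p (slope_at (g \<omega>) z 0) - next_bias p (slope_at (g \<omega>) z n)\<bar> \<le> K" for n
      using next_bias_le[of "slope_at (g \<omega>) z n"] unfolding K_def by linarith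
    then have "(\<lambda>n. (next_bias p (slope_at (g \<omega>) z 0) - next_bias p (slope_at (g \<omega>) z n)) / real n) \<longlonglongrightarrow> 0"
      by (intro Lim_null_comparison[OF _ lim_const_over_n[of K]] always_eventually)
        (simp add: divide_right_mono)
    from tendsto_add_zero[OF lim this]
    show "(\<lambda>n. potential (mean_payoff p) (g \<omega>) z n / real n) \<longlonglongrightarrow> 0"
      by (simp add: potential_eq_martingale[OF p_range] add_divide_distrib diff_divide_distrib add_diff_eq)
  qed
qed

lemma value_N_tendsto: "AE \<omega> in M. (\<lambda>N. value_N M g N \<omega> z) \<longlonglongrightarrow> mean_payoff p"
  using AE_space potential_average
proof eventually_elim
  fix \<omega> assume \<omega>: "\<omega> \<in> space M" "(\<lambda>n. potential (mean_payoff p) (g \<omega>) z n / real n) \<longlonglongrightarrow> 0"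
  interpret payoff_field "g \<omega>" 1 using \<omega>(1) by (rule payoff_field) simp_all
  interpret potential_field "g \<omega>" "mean_payoff p" z
    by unfold_locales (rule mean_payoff_range[OF p_range])+
  show "(\<lambda>N. value_N M g N \<omega> z) \<longlonglongrightarrow> mean_payoff p"
    using V_average_tendsto[OF \<omega>(2)] by (simp add: value_N_eq[OF \<omega>(1)])
qed

text \<open>The parity strategy attains every \<open>N\<close>-stage value, so it serves all
  \<open>\<epsilon>\<close> at once.\<close>

lemma uniform_value: "is_uniform_value M g (mean_payoff p)"
  unfolding is_uniform_value_def
proof (intro conjI allI impI)
  show "is_limit_value M g (mean_payoff p)"
    unfolding is_limit_value_def using value_N_tendsto by blast
  fix \<epsilon> :: real assume "0 < \<epsilon>"
  \<comment> \<open>The states are countable, so one null set serves all of them.\<close>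
  have "AE \<omega> in M. \<forall>z. (\<lambda>N. value_N M g N \<omega> z) \<longlonglongrightarrow> mean_payoff p"
    by (simp add: AE_all_countable value_N_tendsto)
  with AE_space have "AE \<omega> in M. \<forall>z. \<forall>\<^sub>F N in sequentially.
      mean_payoff p - \<epsilon> \<le> payoff_N g N \<omega> z (parity_strategy g)"
  proof eventually_elim
    fix \<omega> assume \<omega>: "\<omega> \<in> space M" "\<forall>z. (\<lambda>N. value_N M g N \<omega> z) \<longlonglongrightarrow> mean_payoff p"
    have "payoff_N g N \<omega> z (parity_strategy g) = value_N M g N \<omega> z" for N z
      using rule_payoff_N[OF obeys_infinity_imp[OF obeys_parity_strategy] \<omega>(1)] value_N_eq[OF \<omega>(1)]
      by simp
    moreover have "\<forall>\<^sub>F N in sequentially. mean_payoff p - \<epsilon> < value_N M g N \<omega> z" for z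
      using \<omega>(2) \<open>0 < \<epsilon>\<close> by (intro order_tendstoD(1)[of _ "mean_payoff p"]) auto
    then have "\<forall>\<^sub>F N in sequentially. mean_payoff p - \<epsilon> \<le> value_N M g N \<omega> z" for z
      by (rule eventually_mono) (rule less_imp_le)
    ultimately show "\<forall>z. \<forall>\<^sub>F N in sequentially. mean_payoff p - \<epsilon> \<le> payoff_N g N \<omega> z (parity_strategy g)"
      by simp
  qed
  then show "\<exists>\<sigma>. strategy M g \<sigma> \<and> (AE \<omega> in M. \<forall>z. \<forall>\<^sub>F N in sequentially.
      mean_payoff p - \<epsilon> \<le> payoff_N g N \<omega> z \<sigma>)"
    using strategy_parity_strategy by blast
qed

end

theorem proposition4p10:
  fixes M :: "'w measure" and g :: "'w \<Rightarrow> int \<Rightarrow> act \<Rightarrow> real" and p :: real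
  assumes "pmdp M g p"
  shows
    "(\<forall>N\<ge>1.
        (\<exists>\<sigma>. strategy M g \<sigma> \<and> obeys M g star_rule (enat N) \<sigma> \<and> obeys M g tie_break (enat N) \<sigma>) \<and>
        (\<forall>\<sigma>. strategy M g \<sigma> \<and> obeys M g star_rule (enat N) \<sigma> \<and> obeys M g tie_break (enat N) \<sigma>
              \<longrightarrow> optimal_N M g N \<sigma>))
     \<and> (\<exists>\<sigma>. strategy M g \<sigma> \<and> obeys M g star_rule \<infinity> \<sigma>)
     \<and> (\<forall>\<sigma>. strategy M g \<sigma> \<and> obeys M g star_rule \<infinity> \<sigma>
              \<longrightarrow> (\<forall>lam. 0 < lam \<and> lam \<le> 1 \<longrightarrow> optimal_disc M g lam \<sigma>))
     \<and> is_uniform_value M g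
         (if p = 0 then 0
          else (p^6 - 2*p^5 - 2*p^4 + 6*p^3 - 4*p^2) / (2*p^5 - 7*p^4 + 7*p^3 - 2*p^2 - p))"
proof -
  interpret pmdp M g p by (rule assms)
  show ?thesis
    unfolding mean_payoff_eq[OF p_range, symmetric]
    using strategy_parity_strategy obeys_parity_strategy obeys_infinity_imp[OF obeys_parity_strategy]
      rule_optimal_N rule_optimal_disc uniform_value
    by blast
qed

end
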